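(* Let $\alpha\in(1,2)$, $\sigma\in\mathbb{R}\setminus\{0\}$, let $(L^\alpha_t)_{t\in\mathbb{R}}$ be either the truncated or the non-truncated $\alpha$-stable process on $\mathbb{R}$, let $\varphi_\beta$ be the random dynamical system generated by $$\mathrm{d}X_t=(\beta X_t-X_t^3)\,\mathrm{d}t+\sigma\,\mathrm{d}L^\alpha_t,\qquad X_0\in\mathbb{R},$$ and let $\{a_\beta(\omega)\}_{\omega\in\Omega}$ be its unique attracting random equilibrium. For $T>0$ define the finite-time Lyapunov exponent $$\lambda_\beta^{T,\omega}:=\frac1T\ln\Big|\frac{\partial\varphi_\beta}{\partial x}(T,\omega,a_\beta(\omega))\Big|.$$ (i) If $\beta<0$, the random attractor $\{a_\beta(\omega)\}_{\omega\in\Omega}$ is finite-time attractive for any $T>0$, i.e. $\lambda_\beta^{T,\omega}\le\beta<0$ for all $\omega\in\Omega$. (ii) If $\beta>0$, the random attractor $\{a_\beta(\omega)\}_{\omega\in\Omega}$ is not finite-time attractive for any $T>0$, i.e. $\mathbb{P}\{\omega\in\Omega:\lambda_\beta^{T,\omega}>0\}>0$.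
   Context: Noise. For $\alpha\in(0,2)$ let $\nu_\alpha(\mathrm{d}z)=c_\alpha|z|^{-1-\alpha}\,\mathrm{d}z$ on $\mathbb{R}\setminus\{0\}$, $c_\alpha=\frac{\alpha}{2^{1-\alpha}\pi^{1/2}}\frac{\Gamma((1+\alpha)/2)}{\Gamma(1-\alpha/2)}$. Let $N$ be the Poisson random measure of jumps and $\widetilde N(t,\mathrm{d}z)=N(t,\mathrm{d}z)-t\nu(\mathrm{d}z)$. The non-truncated process is the two-sided symmetric $\alpha$-stable Lévy process, with $\nu=\nu_\alpha$ and $L_t=\int_{|z|<1}z\,\widetilde N(t,\mathrm{d}z)+\int_{|z|\ge1}z\,N(t,\mathrm{d}z)$. The truncated process is the two-sided Lévy process with $\nu=\nu_\alpha|_{\{|z|<1\}}$ and $L_t=\int_{|z|<1}z\,\widetilde N(t,\mathrm{d}z)$. Random dynamical system. $(\Omega,\mathcal F,\mathbb P)$ is the canonical space of two-sided càdlàg paths with $L_t(\omega)=\omega(t)$, $\omega(0)=0$, and $\theta_t\omega(\cdot)=\omega(t+\cdot)-\omega(t)$. The equation generates a random dynamical system (cocycle) $\varphi=\varphi_\beta$ over $\theta$: $\varphi(t,\omega,x)$ is the solution at time $t\ge0$ started at $x$ at time $0$. Random equilibrium. The system has a (pullback) random attractor consisting of a single point $\{a_\beta(\omega)\}$: $a_\beta:\Omega\to\mathbb{R}$ is measurable and, $\mathbb P$-a.s., $\varphi(t,\omega,a_\beta(\omega))=a_\beta(\theta_t\omega)$ for all $t\ge0$ and $\lim_{t\to\infty}\sup_{x\in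 B}|\varphi(t,\theta_{-t}\omega,x)-a_\beta(\omega)|=0$ for every bounded $B\subset\mathbb{R}$. The linearization along $a_\beta$ is $\frac{\partial\varphi_\beta}{\partial x}(t,\omega,a_\beta(\omega))=\exp\big(\int_0^t(\beta-3a_\beta(\theta_s\omega)^2)\,\mathrm{d}s\big)$. *)

theory Defs
  imports "HOL-Probability.Probability"
begin

section \<open>The canonical space of two-sided cadlag paths\<close>

definition cadlag :: "(real \<Rightarrow> real) \<Rightarrow> bool" where
  "cadlag \<omega> \<longleftrightarrow> (\<forall>t. continuous (at_right t) \<omega> \<and> (\<exists>l. (\<omega> \<longlongrightarrow> l) (at_left t)))"

definition path_space :: "(real \<Rightarrow> real) set" where
  "path_space = {\<omega>. cadlag \<omega> \<and> \<omega> 0 = 0}"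

text \<open>The sigma-algebra generated by the coordinate maps (only \<^const>\<open>space\<close> and
  \<^const>\<open>sets\<close> of this measure are used).\<close>

definition canonical_space :: "(real \<Rightarrow> real) measure" where
  "canonical_space = restrict_space (PiM UNIV (\<lambda>_::real. borel)) path_space"

definition shift :: "real \<Rightarrow> (real \<Rightarrow> real) \<Rightarrow> (real \<Rightarrow> real)" where
  "shift t \<omega> = (\<lambda>s. \<omega> (t + s) - \<omega> t)"

section \<open>Jumps and Poisson random measures\<close>

definition jump :: "(real \<Rightarrow> real) \<Rightarrow> real \<Rightarrow> real" where
  "jump \<omega> t = \<omega> t - Lim (at_left t) \<omega>"

text \<open>The point measure of all (time, jump size) pairs of a path; \<open>N(t,A)\<close> is
  the mass of \<open>{0<..t} \<times> A\<close>.\<close>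

definition jump_measure :: "(real \<Rightarrow> real) \<Rightarrow> (real \<times> real) measure" where
  "jump_measure \<omega> =
     distr (count_space {u. jump \<omega> u \<noteq> 0}) (borel \<Otimes>\<^sub>M borel) (\<lambda>u. (u, jump \<omega> u))"

text \<open>Sets of infinite intensity carry infinitely many points almost surely. The Poisson
  weights are written out because \<^const>\<open>poisson_pmf\<close> is meaningful for positive rates only,
  while intensity 0 has to be allowed.\<close>

definition poisson_random_measure ::
  "'w measure \<Rightarrow> ('w \<Rightarrow> 'e measure) \<Rightarrow> 'e measure \<Rightarrow> bool" where
  "poisson_random_measure P N \<mu> \<longleftrightarrow>
     (\<forall>\<omega>\<in>space P. sets (N \<omega>) = sets \<mu>) \<and>
     (\<forall>D\<in>sets \<mu>. (\<lambda>\<omega>. emeasure (N \<omega>) D) \<in> borel_measurable P) \<and>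
     (\<forall>D\<in>sets \<mu>. emeasure \<mu> D < \<infinity> \<longrightarrow>
        (\<forall>k::nat. measure P {\<omega> \<in> space P. emeasure (N \<omega>) D = of_nat k}
                   = exp (- measure \<mu> D) * measure \<mu> D ^ k / fact k)) \<and>
     (\<forall>D\<in>sets \<mu>. emeasure \<mu> D = \<infinity> \<longrightarrow> (AE \<omega> in P. emeasure (N \<omega>) D = \<infinity>)) \<and>
     (\<forall>(D :: nat \<Rightarrow> 'e set) n. range D \<subseteq> sets \<mu> \<longrightarrow> disjoint_family D \<longrightarrow>
        prob_space.indep_vars P (\<lambda>_. borel) (\<lambda>i \<omega>. emeasure (N \<omega>) (D i)) {..<n})"

section \<open>Two-sided Levy processes on the canonical space\<close>

definition two_sided_levy_process :: "(real \<Rightarrow> real) measure \<Rightarrow> bool" where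
  "two_sided_levy_process P \<longleftrightarrow>
     prob_space P \<and> space P = space canonical_space \<and> sets P = sets canonical_space \<and>
     (\<forall>(\<tau> :: nat \<Rightarrow> real) n. mono \<tau> \<longrightarrow>
        prob_space.indep_vars P (\<lambda>_. borel) (\<lambda>i \<omega>. \<omega> (\<tau> (Suc i)) - \<omega> (\<tau> i)) {..<n}) \<and>
     (\<forall>s t h. distr P borel (\<lambda>\<omega>. \<omega> (t + h) - \<omega> (s + h)) = distr P borel (\<lambda>\<omega>. \<omega> t - \<omega> s)) \<and>
     (\<forall>t. \<forall>\<epsilon>>0. ((\<lambda>s. measure P {\<omega> \<in> space P. \<bar>\<omega> s - \<omega> t\<bar> > \<epsilon>}) \<longlongrightarrow> 0) (at t))"

definition levy_measure_of :: "real measure \<Rightarrow> (real \<Rightarrow> real) measure \<Rightarrow> bool" where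
  "levy_measure_of \<nu> P \<longleftrightarrow> poisson_random_measure P jump_measure (lborel \<Otimes>\<^sub>M \<nu>)"

definition jump_integral :: "real set \<Rightarrow> real \<Rightarrow> real \<Rightarrow> (real \<Rightarrow> real) \<Rightarrow> real" where
  "jump_integral A s t \<omega> = set_lebesgue_integral (jump_measure \<omega>) ({s<..t} \<times> A) snd"

definition compensated_jump_integral ::
  "real measure \<Rightarrow> real set \<Rightarrow> real \<Rightarrow> real \<Rightarrow> (real \<Rightarrow> real) \<Rightarrow> real" where
  "compensated_jump_integral \<nu> A s t \<omega> =
     jump_integral A s t \<omega> - (t - s) * set_lebesgue_integral \<nu> A (\<lambda>z. z)"

text \<open>\<open>Y\<close> is the stochastic integral of \<open>z\<close> over \<open>{s<..t} \<times> {|z| < 1}\<close> against the compensated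
  jump measure. There are infinitely many small jumps, so this integral is an \<open>L\<^sup>2\<close> limit.\<close>

definition is_small_jump_integral ::
  "(real \<Rightarrow> real) measure \<Rightarrow> real measure \<Rightarrow> real \<Rightarrow> real \<Rightarrow> ((real \<Rightarrow> real) \<Rightarrow> real) \<Rightarrow> bool" where
  "is_small_jump_integral P \<nu> s t Y \<longleftrightarrow>
     ((\<lambda>\<epsilon>. \<integral>\<^sup>+\<omega>. ennreal ((Y \<omega> - compensated_jump_integral \<nu> {z. \<epsilon> < \<bar>z\<bar> \<and> \<bar>z\<bar> < 1} s t \<omega>)\<^sup>2) \<partial>P)
        \<longlongrightarrow> 0) (at_right 0)"

section \<open>Stable and truncated stable processes\<close>

definition stable_const :: "real \<Rightarrow> real" where
  "stable_const \<alpha> =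
     \<alpha> / (2 powr (1 - \<alpha>) * sqrt pi) * (Gamma ((1 + \<alpha>) / 2) / Gamma (1 - \<alpha> / 2))"

text \<open>A measure on the whole line without mass at 0.\<close>

definition stable_levy_measure :: "real \<Rightarrow> real measure" where
  "stable_levy_measure \<alpha> =
     density lborel (\<lambda>z. ennreal (stable_const \<alpha> * \<bar>z\<bar> powr (- 1 - \<alpha>)))"

definition truncated_stable_levy_measure :: "real \<Rightarrow> real measure" where
  "truncated_stable_levy_measure \<alpha> =
     density (stable_levy_measure \<alpha>) (indicator {z. \<bar>z\<bar> < 1})"

text \<open>The Levy-Ito representations are stated for increments. As paths vanish at time 0,
  \<open>s = 0\<close> gives the formula for \<open>L\<^sub>t\<close> with \<open>t \<ge> 0\<close>, and \<open>t = 0\<close> gives the one for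
  negative times.\<close>

definition stable_process :: "real \<Rightarrow> (real \<Rightarrow> real) measure \<Rightarrow> bool" where
  "stable_process \<alpha> P \<longleftrightarrow>
     two_sided_levy_process P \<and> levy_measure_of (stable_levy_measure \<alpha>) P \<and>
     (\<forall>s t. s \<le> t \<longrightarrow> is_small_jump_integral P (stable_levy_measure \<alpha>) s t
        (\<lambda>\<omega>. \<omega> t - \<omega> s - jump_integral {z. \<bar>z\<bar> \<ge> 1} s t \<omega>))"

definition truncated_stable_process :: "real \<Rightarrow> (real \<Rightarrow> real) measure \<Rightarrow> bool" where
  "truncated_stable_process \<alpha> P \<longleftrightarrow>
     two_sided_levy_process P \<and> levy_measure_of (truncated_stable_levy_measure \<alpha>) P \<and>
     (\<forall>s t. s \<le> t \<longrightarrow> is_small_jump_integral P (truncated_stable_levy_measure \<alpha>) s t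
        (\<lambda>\<omega>. \<omega> t - \<omega> s))"

section \<open>The random dynamical system\<close>

definition random_dynamical_system ::
  "(real \<Rightarrow> real) measure \<Rightarrow> (real \<Rightarrow> (real \<Rightarrow> real) \<Rightarrow> real \<Rightarrow> real) \<Rightarrow> bool" where
  "random_dynamical_system P \<phi> \<longleftrightarrow>
     (\<lambda>(t, \<omega>, x). \<phi> t \<omega> x)
        \<in> borel_measurable (restrict_space borel {0..} \<Otimes>\<^sub>M P \<Otimes>\<^sub>M borel) \<and>
     (\<forall>\<omega>\<in>space P. \<forall>x. \<phi> 0 \<omega> x = x) \<and>
     (\<forall>\<omega>\<in>space P. \<forall>s\<ge>0. \<forall>t\<ge>0. \<forall>x. \<phi> (s + t) \<omega> x = \<phi> t (shift s \<omega>) (\<phi> s \<omega> x))"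

text \<open>The noise is additive, so the equation is a pathwise integral equation.\<close>

definition solves_sde ::
  "real \<Rightarrow> real \<Rightarrow> (real \<Rightarrow> real) \<Rightarrow> real \<Rightarrow> (real \<Rightarrow> real) \<Rightarrow> bool" where
  "solves_sde \<beta> \<sigma> \<omega> x X \<longleftrightarrow>
     (\<forall>t\<ge>0. (\<lambda>s. \<beta> * X s - X s ^ 3) integrable_on {0..t} \<and>
        X t = x + integral {0..t} (\<lambda>s. \<beta> * X s - X s ^ 3) + \<sigma> * \<omega> t)"

definition generated_rds ::
  "(real \<Rightarrow> real) measure \<Rightarrow> real \<Rightarrow> real \<Rightarrow> (real \<Rightarrow> (real \<Rightarrow> real) \<Rightarrow> real \<Rightarrow> real) \<Rightarrow> bool" where
  "generated_rds P \<beta> \<sigma> \<phi> \<longleftrightarrow>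
     random_dynamical_system P \<phi> \<and>
     (\<forall>\<omega>\<in>space P. \<forall>x. solves_sde \<beta> \<sigma> \<omega> x (\<lambda>t. \<phi> t \<omega> x))"

definition attracting_random_equilibrium ::
  "(real \<Rightarrow> real) measure \<Rightarrow> (real \<Rightarrow> (real \<Rightarrow> real) \<Rightarrow> real \<Rightarrow> real) \<Rightarrow>
   ((real \<Rightarrow> real) \<Rightarrow> real) \<Rightarrow> bool" where
  "attracting_random_equilibrium P \<phi> a \<longleftrightarrow>
     a \<in> borel_measurable P \<and>
     (AE \<omega> in P.
        (\<forall>t\<ge>0. \<phi> t \<omega> (a \<omega>) = a (shift t \<omega>)) \<and>
        (\<forall>B. bounded B \<longrightarrow>
           ((\<lambda>t. SUP x\<in>B. ennreal \<bar>\<phi> t (shift (- t) \<omega>) x - a \<omega>\<bar>) \<longlongrightarrow> 0) at_top))"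

definition finite_time_lyapunov ::
  "(real \<Rightarrow> (real \<Rightarrow> real) \<Rightarrow> real \<Rightarrow> real) \<Rightarrow> ((real \<Rightarrow> real) \<Rightarrow> real) \<Rightarrow>
   real \<Rightarrow> (real \<Rightarrow> real) \<Rightarrow> real" where
  "finite_time_lyapunov \<phi> a T \<omega> = 1 / T * ln \<bar>deriv (\<lambda>x. \<phi> T \<omega> x) (a \<omega>)\<bar>"

end

theory Submission
  imports Defs
begin

text \<open>The difference of two solutions driven by the same path solves a linear equation, so the flow
  is differentiable in the initial value with derivative \<open>exp (\<integral>\<^sub>0\<^sup>T \<beta> - 3 X\<^sub>s\<^sup>2 ds)\<close> for every path, which
  settles \<open>\<beta> < 0\<close>. Paths only have one-sided limits; hence all differential arguments use right
  derivatives.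

  For \<open>\<beta> > 0\<close> the noise is steered. Let \<open>Y\<close> stay at \<open>c = sqrt (3 \<beta>)\<close> for a long time \<open>S\<close>, then go to
  \<open>0\<close> within one unit of time and remain there. If \<open>\<sigma> L\<close> is uniformly close to the forcing that makes
  \<open>Y\<close> a solution, then every solution, whatever its initial value, is close to \<open>Y\<close> after time \<open>S\<close>,
  because the cubic drift comes down from infinity and contracts near \<open>c\<close>. By pullback attraction
  the equilibrium itself then stays near \<open>0\<close> on \<open>[0,T]\<close>, where the linearization expands. As this
  event constrains the noise alone, no information on the law of the equilibrium is needed.

  Such noise has positive probability for every continuous forcing \<open>f\<close>. With positive probability
  \<open>L - f\<close> oscillates little on a short interval and has an increment close to some \<open>y\<close>. Replacing a tiny
  cell of the interval by an independent one that contains a jump close to \<open>-y\<close> brings \<open>L - f\<close> back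
  near its initial value, and such intervals can be concatenated. This only needs jumps of all sizes in
  \<open>(-1,1)\<close>, not the Levy-Ito decomposition.\<close>

section \<open>Functions with a right derivative\<close>

lemma compact_sublevel:
  fixes f :: "real \<Rightarrow> real"
  assumes "continuous_on {a..b} f"
  shows "compact {t\<in>{a..b}. f t \<le> c}"
proof -
  have "closed ({a..b} \<inter> f -` {..c})"
    by (rule continuous_closed_preimage[OF assms]) auto
  moreover have "{t\<in>{a..b}. f t \<le> c} = {a..b} \<inter> f -` {..c}" by auto
  moreover have "bounded {t\<in>{a..b}. f t \<le> c}"
    by (rule bounded_subset[of "{a..b}"]) auto
  ultimately show ?thesis by (simp add: compact_eq_bounded_closed)
qed

text \<open>The mean value theorem is out of reach with one-sided derivatives. Tilting
  \<open>f\<close> by an arbitrarily small slope \<open>k\<close> makes the right derivative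
  strictly negative, so the tilted function \<open>g\<close> would decrease further after the last
  time at which it is nonpositive, a contradiction.\<close>

lemma le_of_right_derivative_nonpos:
  fixes f :: "real \<Rightarrow> real"
  assumes "a \<le> b" and cont: "continuous_on {a..b} f"
    and der: "\<And>t. a \<le> t \<Longrightarrow> t < b \<Longrightarrow> \<exists>d\<le>0. (f has_real_derivative d) (at_right t)"
  shows "f b \<le> f a"
proof (rule field_le_epsilon)
  fix e :: real assume "e > 0"
  \<comment> \<open>The \<open>+ 1\<close> covers the degenerate interval
    \<open>a = b\<close>.\<close>
  define k where "k = e / (b - a + 1)"
  have k: "k > 0" "k * (b - a) \<le> e"
    using \<open>e > 0\<close> \<open>a \<le> b\<close> by (auto simp: k_def field_simps)
  define g where "g t = f t - f a - k * (t - a)" for t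
  have "g b \<le> 0"
  proof (rule ccontr)
    assume gb: "\<not> g b \<le> 0"
    have cg: "continuous_on {a..b} g"
      unfolding g_def by (intro continuous_intros cont)
    have "compact {t\<in>{a..b}. g t \<le> 0}"
      by (rule compact_sublevel[OF cg])
    moreover have "a \<in> {t\<in>{a..b}. g t \<le> 0}"
      using \<open>a \<le> b\<close> by (auto simp: g_def)
    ultimately obtain t0 where t0: "t0 \<in> {a..b}" "g t0 \<le> 0"
      and last: "\<And>t. t \<in> {a..b} \<Longrightarrow> g t \<le> 0 \<Longrightarrow> t \<le> t0"
      using compact_attains_sup[of "{t\<in>{a..b}. g t \<le> 0}"] by blast
    have "t0 < b" using gb t0 by (metis atLeastAtMost_iff order_le_less)
    then obtain d where d: "d \<le> 0" "(f has_real_derivative d) (at_right t0)"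
      using der t0 by auto
    have "(g has_real_derivative d - k) (at_right t0)"
      unfolding g_def by (rule derivative_eq_intros d refl | simp)+
    from has_real_derivative_neg_dec_right[OF this]
    obtain r where r: "r > 0" "\<And>h. h > 0 \<Longrightarrow> h < r \<Longrightarrow> g (t0 + h) < g t0"
      using d k by auto
    define h where "h = min (r/2) (b - t0)"
    have "h > 0" "h < r" "t0 + h \<le> b" using r \<open>t0 < b\<close> by (auto simp: h_def min_def)
    then have "t0 + h \<le> t0" using last[of "t0 + h"] r(2)[of h] t0 by auto
    then show False using \<open>h > 0\<close> by simp
  qed
  then show "f b \<le> f a + e" using k by (simp add: g_def)
qed

text \<open>After the last time with \<open>f t \<le> M\<close> the sign condition holds throughout,
  so \<open>f\<close> cannot climb any more.\<close>

lemma right_derivative_barrier: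
  fixes f :: "real \<Rightarrow> real"
  assumes "a \<le> b" and cont: "continuous_on {a..b} f" and start: "f a \<le> M"
    and der: "\<And>t. a \<le> t \<Longrightarrow> t < b \<Longrightarrow> f t > M \<Longrightarrow> \<exists>d\<le>0. (f has_real_derivative d) (at_right t)"
  shows "f b \<le> M"
proof (rule ccontr)
  assume fb: "\<not> f b \<le> M"
  have "compact {t\<in>{a..b}. f t \<le> M}"
    by (rule compact_sublevel[OF cont])
  moreover have "a \<in> {t\<in>{a..b}. f t \<le> M}"
    using \<open>a \<le> b\<close> start by auto
  ultimately obtain t0 where t0: "t0 \<in> {a..b}" "f t0 \<le> M"
    and last: "\<And>t. t \<in> {a..b} \<Longrightarrow> f t \<le> M \<Longrightarrow> t \<le> t0"
    using compact_attains_sup[of "{t\<in>{a..b}. f t \<le> M}"] by blast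
  \<comment> \<open>The sign condition need not hold at \<open>t0\<close> itself. Monotonicity is
    therefore applied from a later time, at which \<open>f\<close> takes a level strictly between
    \<open>M\<close> and \<open>f b\<close>.\<close>
  define m where "m = (M + f b) / 2"
  have "\<exists>t\<ge>t0. t \<le> b \<and> f t = m"
    by (rule IVT') (use t0 fb in \<open>auto simp: m_def intro: continuous_on_subset[OF cont]\<close>)
  then obtain t where t: "t0 \<le> t" "t \<le> b" "f t = m" by auto
  have "t \<noteq> t0" using t(3) t0(2) fb by (auto simp: m_def)
  then have "t0 < t" using t by simp
  have "f b \<le> f t"
  proof (rule le_of_right_derivative_nonpos[OF t(2)])
    show "continuous_on {t..b} f" using cont t0 t by (auto intro: continuous_on_subset)
    fix s assume s: "t \<le> s" "s < b"
    then have "f s > M" using last[of s] t0 \<open>t0 < t\<close> by fastforce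
    then show "\<exists>d\<le>0. (f has_real_derivative d) (at_right s)"
      using der[of s] s t0 t by auto
  qed
  then show False using t(3) fb by (simp add: m_def)
qed

lemma right_derivative_zero_constant:
  fixes f :: "real \<Rightarrow> real"
  assumes "a \<le> b" and cont: "continuous_on {a..b} f"
    and der: "\<And>t. a \<le> t \<Longrightarrow> t < b \<Longrightarrow> (f has_real_derivative 0) (at_right t)"
  shows "f b = f a"
proof (rule antisym)
  show "f b \<le> f a"
    by (rule le_of_right_derivative_nonpos[OF \<open>a \<le> b\<close> cont]) (use der in blast)
  have "((\<lambda>t. - f t) has_real_derivative 0) (at_right t)" if "a \<le> t" "t < b" for t
    using DERIV_minus[OF der[OF that]] by simp
  then have "- f b \<le> - f a"
    by (intro le_of_right_derivative_nonpos[of a b "\<lambda>t. - f t"] continuous_intros cont \<open>a \<le> b\<close>) blast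
  then show "f a \<le> f b" by simp
qed

text \<open>The integral is split at \<open>t\<close>: on \<open>{t..b}\<close> right continuity at
  \<open>t\<close> is continuity relative to the interval, so the usual fundamental theorem
  applies.\<close>

lemma integral_has_right_derivative:
  fixes f :: "real \<Rightarrow> real"
  assumes int: "f integrable_on {a..b}" and t: "a \<le> t" "t < b"
    and cont: "continuous (at_right t) f"
  shows "((\<lambda>u. integral {a..u} f) has_real_derivative f t) (at_right t)"
proof -
  have "f integrable_on {t..b}"
    by (rule integrable_subinterval_real[OF int]) (use t in auto)
  then have "((\<lambda>u. integral {t..u} f) has_vector_derivative f t) (at t within ({t..b} - {}))"
    by (rule integral_has_vector_derivative_continuous_at)
      (use t cont in \<open>auto simp: at_within_Icc_at_right\<close>)
  then have "((\<lambda>u. integral {t..u} f) has_real_derivative f t) (at_right t)"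
    using t by (simp add: at_within_Icc_at_right has_real_derivative_iff_has_vector_derivative)
  then have D: "((\<lambda>u. integral {a..t} f + integral {t..u} f) has_real_derivative f t) (at_right t)"
    by (auto intro!: derivative_eq_intros)
  have "integral {a..t} f + integral {t..u} f = integral {a..u} f" if "t < u" "u < b" for u
    by (rule Henstock_Kurzweil_Integration.integral_combine)
      (use t that in \<open>auto intro: integrable_subinterval_real[OF int]\<close>)
  then have ev: "\<forall>\<^sub>F u in at_right t. integral {a..t} f + integral {t..u} f = integral {a..u} f"
    unfolding eventually_at_right[OF t(2)] using t(2) by blast
  show ?thesis
    by (rule has_field_derivative_cong_eventually[THEN iffD1, OF ev _ D]) simp
qed

section \<open>Pathwise analysis of the equation\<close>

text \<open>Boundedness passes to unions of adjacent intervals and holds near every point by the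
  one-sided limits; the bisection principle \<open>Bolzano\<close> makes it global on
  \<open>{a..b}\<close>.\<close>

lemma cadlag_bounded:
  assumes "cadlag w" "a \<le> b"
  shows "\<exists>K. \<forall>t\<in>{a..b}. \<bar>w t\<bar> \<le> K"
proof (rule Bolzano[where P="\<lambda>a b. \<exists>K. \<forall>t\<in>{a..b}. \<bar>w t\<bar> \<le> K", OF assms(2)])
  fix a b c
  assume "\<exists>K. \<forall>t\<in>{a..b}. \<bar>w t\<bar> \<le> K" "\<exists>K. \<forall>t\<in>{b..c}. \<bar>w t\<bar> \<le> K"
  then obtain K L where "\<forall>t\<in>{a..b}. \<bar>w t\<bar> \<le> K" "\<forall>t\<in>{b..c}. \<bar>w t\<bar> \<le> L" by auto
  then have "\<forall>t\<in>{a..c}. \<bar>w t\<bar> \<le> max K L"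
    by (metis atLeastAtMost_iff le_max_iff_disj linear)
  then show "\<exists>K. \<forall>t\<in>{a..c}. \<bar>w t\<bar> \<le> K" by blast
next
  fix x
  obtain l where l: "(w \<longlongrightarrow> l) (at_left x)" and r: "(w \<longlongrightarrow> w x) (at_right x)"
    using assms(1) by (auto simp: cadlag_def continuous_within)
  have "\<forall>\<^sub>F t in at_left x. dist (w t) l < 1" "\<forall>\<^sub>F t in at_right x. dist (w t) (w x) < 1"
    using tendstoD[OF l, of 1] tendstoD[OF r, of 1] by auto
  then obtain d1 d2 where d: "d1 < x" "\<And>t. t > d1 \<Longrightarrow> t < x \<Longrightarrow> dist (w t) l < 1"
    "d2 > x" "\<And>t. t > x \<Longrightarrow> t < d2 \<Longrightarrow> dist (w t) (w x) < 1"
    unfolding eventually_at_left[of "x - 1" x, simplified]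
      eventually_at_right[of x "x + 1", simplified] by auto
  define K where "K = \<bar>l\<bar> + \<bar>w x\<bar> + 1"
  have K: "\<bar>w t\<bar> \<le> K" if "d1 < t" "t < d2" for t
    using d(2)[of t] d(4)[of t] that
    by (cases t x rule: linorder_cases) (auto simp: K_def dist_real_def)
  show "\<exists>d>0. \<forall>a b. a \<le> x \<and> x \<le> b \<and> b - a < d \<longrightarrow> (\<exists>K. \<forall>t\<in>{a..b}. \<bar>w t\<bar> \<le> K)"
  proof (rule exI[of _ "min (x - d1) (d2 - x)"], intro conjI allI impI)
    show "0 < min (x - d1) (d2 - x)" using d by auto
    fix a b assume "a \<le> x \<and> x \<le> b \<and> b - a < min (x - d1) (d2 - x)"
    then show "\<exists>K. \<forall>t\<in>{a..b}. \<bar>w t\<bar> \<le> K"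
      by (intro exI[of _ K]) (auto intro!: K)
  qed
qed

lemma solves_sde_integral:
  assumes "solves_sde \<beta> \<sigma> w x X" "0 \<le> t"
  shows "(\<lambda>s. \<beta> * X s - X s ^ 3) integrable_on {0..t}"
    and "X t = x + integral {0..t} (\<lambda>s. \<beta> * X s - X s ^ 3) + \<sigma> * w t"
  using assms by (auto simp: solves_sde_def)

lemma solves_sde_right_continuous:
  assumes "solves_sde \<beta> \<sigma> w x X" "cadlag w" "0 \<le> t"
  shows "continuous (at_right t) X"
proof -
  let ?p = "\<lambda>s. \<beta> * X s - X s ^ 3"
  have "continuous_on {0..t+1} (\<lambda>u. integral {0..u} ?p)"
    using solves_sde_integral(1)[OF assms(1), of "t+1"] assms(3)
    by (intro indefinite_integral_continuous_1) auto
  then have "continuous (at t within {0..t+1}) (\<lambda>u. integral {0..u} ?p)"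
    using assms(3) by (auto simp: continuous_on_eq_continuous_within)
  then have "continuous (at t within {t..t+1}) (\<lambda>u. integral {0..u} ?p)"
    by (rule continuous_within_subset) (use assms(3) in auto)
  then have I: "continuous (at_right t) (\<lambda>u. integral {0..u} ?p)"
    by (simp add: at_within_Icc_at_right)
  have "continuous (at_right t) w" using assms(2) by (auto simp: cadlag_def)
  with I have "continuous (at_right t) (\<lambda>u. x + integral {0..u} ?p + \<sigma> * w u)"
    by (intro continuous_intros)
  then have "((\<lambda>u. x + integral {0..u} ?p + \<sigma> * w u) \<longlongrightarrow> X t) (at_right t)"
    using solves_sde_integral(2)[OF assms(1,3)] by (simp add: continuous_within)
  moreover have "\<forall>\<^sub>F u in at_right t. x + integral {0..u} ?p + \<sigma> * w u = X u"
    using solves_sde_integral(2)[OF assms(1)] assms(3)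
    by (auto simp: eventually_at_filter)
  ultimately show ?thesis
    unfolding continuous_within by (rule Lim_transform_eventually)
qed

lemma solves_sde_bounded:
  assumes "solves_sde \<beta> \<sigma> w x X" "cadlag w" "0 \<le> T"
  shows "\<exists>K. \<forall>t\<in>{0..T}. \<bar>X t\<bar> \<le> K"
proof -
  let ?p = "\<lambda>s. \<beta> * X s - X s ^ 3"
  obtain K where K: "\<And>t. t \<in> {0..T} \<Longrightarrow> \<bar>w t\<bar> \<le> K" using cadlag_bounded[OF assms(2,3)] by blast
  have "continuous_on {0..T} (\<lambda>u. integral {0..u} ?p)"
    using solves_sde_integral(1)[OF assms(1,3)]
    by (intro indefinite_integral_continuous_1) auto
  then have "compact ((\<lambda>u. integral {0..u} ?p) ` {0..T})"
    by (rule compact_continuous_image) simp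
  then obtain L where L: "\<And>t. t \<in> {0..T} \<Longrightarrow> \<bar>integral {0..t} ?p\<bar> \<le> L"
    using compact_imp_bounded bounded_iff by (metis (no_types, lifting) imageI real_norm_def)
  have "\<bar>X t\<bar> \<le> \<bar>x\<bar> + L + \<bar>\<sigma>\<bar> * K" if t: "t \<in> {0..T}" for t
  proof -
    have "\<bar>\<sigma> * w t\<bar> \<le> \<bar>\<sigma>\<bar> * K" using K[OF t] by (simp add: abs_mult mult_left_mono)
    then show ?thesis
      using solves_sde_integral(2)[OF assms(1), of t] L[OF t] t by auto
  qed
  then show ?thesis by blast
qed

lemma solves_sde_drift_right_derivative:
  assumes "solves_sde \<beta> \<sigma> w x X" "cadlag w" "0 \<le> t"
  shows "((\<lambda>u. integral {0..u} (\<lambda>s. \<beta> * X s - X s ^ 3)) has_real_derivative \<beta> * X t - X t ^ 3)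
    (at_right t)"
proof (rule integral_has_right_derivative)
  show "(\<lambda>s. \<beta> * X s - X s ^ 3) integrable_on {0..t+1}"
    using assms by (intro solves_sde_integral(1)) auto
  show "continuous (at_right t) (\<lambda>s. \<beta> * X s - X s ^ 3)"
    by (intro continuous_intros solves_sde_right_continuous[OF assms])
qed (use assms in auto)

lemma bounded_measurable_integrable_on:
  fixes f :: "real \<Rightarrow> real"
  assumes "f \<in> borel_measurable (restrict_space borel {0..})" "\<And>t. t \<in> {0..T} \<Longrightarrow> \<bar>f t\<bar> \<le> K"
  shows "f integrable_on {0..T}"
proof -
  \<comment> \<open>Composition with \<open>max 0\<close> extends \<open>f\<close> from the
    half-line to a Borel function on the line that agrees with \<open>f\<close> on
    \<open>{0..T}\<close>.\<close>
  have "(\<lambda>t. f (max 0 t)) \<in> borel_measurable borel"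
    by (rule measurable_compose[OF _ assms(1)]) (auto intro!: measurable_restrict_space2)
  then have "(\<lambda>t. f (max 0 t)) \<in> borel_measurable (lebesgue_on {0..T})"
    by (intro measurable_restrict_space1 measurable_completion) simp
  then have "(\<lambda>t. f (max 0 t)) integrable_on {0..T}"
    by (rule measurable_bounded_by_integrable_imp_integrable[where g="\<lambda>_. K"])
      (use assms(2) in auto)
  then show ?thesis
    by (rule integrable_eq) auto
qed

section \<open>Comparison of two solutions driven by the same path\<close>

lemma quadratic_form_nonneg: "0 \<le> x^2 + x * y + (y::real)^2"
proof -
  have "x^2 + x * y + y^2 = (x + y/2)^2 + 3/4 * y^2" by (simp add: power2_eq_square field_simps)
  then show ?thesis by simp
qed

text \<open>The additive noise cancels in \<open>Y - X\<close>, and factoring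
  \<open>Y^3 - X^3\<close> leaves a linear equation with coefficient \<open>c\<close>. An
  integrating factor turns the difference into a constant.\<close>

lemma solves_sde_difference:
  assumes X: "solves_sde \<beta> \<sigma> w x X" "X \<in> borel_measurable (restrict_space borel {0..})"
    and Y: "solves_sde \<beta> \<sigma> w y Y" "Y \<in> borel_measurable (restrict_space borel {0..})"
    and w: "cadlag w" and T: "0 \<le> T"
  defines "c \<equiv> \<lambda>s. \<beta> - (X s ^ 2 + X s * Y s + Y s ^ 2)"
  shows "c integrable_on {0..T}"
    and "Y T - X T = (y - x) * exp (integral {0..T} c)"
proof -
  have int: "c integrable_on {0..t}" if t: "0 \<le> t" for t
  proof -
    obtain K where K: "\<And>s. s \<in> {0..t} \<Longrightarrow> \<bar>X s\<bar> \<le> K" using solves_sde_bounded[OF X(1) w t] by blast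
    obtain L where L: "\<And>s. s \<in> {0..t} \<Longrightarrow> \<bar>Y s\<bar> \<le> L" using solves_sde_bounded[OF Y(1) w t] by blast
    show ?thesis
    proof (rule bounded_measurable_integrable_on)
      show "c \<in> borel_measurable (restrict_space borel {0..})"
        unfolding c_def using X(2) Y(2) by measurable
      fix s assume s: "s \<in> {0..t}"
      have "\<bar>X s\<bar> * \<bar>X s\<bar> \<le> K * K" "\<bar>X s\<bar> * \<bar>Y s\<bar> \<le> K * L" "\<bar>Y s\<bar> * \<bar>Y s\<bar> \<le> L * L"
        by (rule mult_mono; use K[OF s] L[OF s] in linarith)+
      then have "\<bar>X s ^ 2\<bar> \<le> K * K" "\<bar>X s * Y s\<bar> \<le> K * L" "\<bar>Y s ^ 2\<bar> \<le> L * L"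
        by (simp_all only: power2_eq_square abs_mult)
      then show "\<bar>c s\<bar> \<le> \<bar>\<beta>\<bar> + K * K + K * L + L * L"
        unfolding c_def by linarith
    qed
  qed
  show "c integrable_on {0..T}" by (rule int[OF T])
  let ?p = "\<lambda>X s. \<beta> * X s - X s ^ 3"
  define g where "g t = ((y - x) + integral {0..t} (?p Y) - integral {0..t} (?p X))
    * exp (- integral {0..t} c)" for t
  have "g T = g 0"
  proof (rule right_derivative_zero_constant[OF T])
    show "continuous_on {0..T} g"
      unfolding g_def
      by (intro continuous_intros indefinite_integral_continuous_1 int[OF T]
          solves_sde_integral(1)[OF X(1) T] solves_sde_integral(1)[OF Y(1) T])
    fix t :: real assume t: "0 \<le> t" "t < T"
    have dc: "((\<lambda>u. integral {0..u} c) has_real_derivative c t) (at_right t)"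
    proof (rule integral_has_right_derivative[OF int[OF T] t])
      show "continuous (at_right t) c"
        unfolding c_def
        by (intro continuous_intros solves_sde_right_continuous[OF X(1) w t(1)]
            solves_sde_right_continuous[OF Y(1) w t(1)])
    qed
    have D: "(y - x) + integral {0..t} (?p Y) - integral {0..t} (?p X) = Y t - X t"
      using solves_sde_integral(2)[OF X(1) t(1)]
        solves_sde_integral(2)[OF Y(1) t(1)] by simp
    note dX = solves_sde_drift_right_derivative[OF X(1) w t(1)]
    note dY = solves_sde_drift_right_derivative[OF Y(1) w t(1)]
    have "(g has_real_derivative
        (?p Y t - ?p X t) * exp (- integral {0..t} c)
        + (- c t * exp (- integral {0..t} c))
          * ((y - x) + integral {0..t} (?p Y) - integral {0..t} (?p X))) (at_right t)"
      unfolding g_def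
      by (rule derivative_eq_intros dX dY dc refl | simp)+
    moreover have "(?p Y t - ?p X t) * exp (- integral {0..t} c)
        + (- c t * exp (- integral {0..t} c))
          * ((y - x) + integral {0..t} (?p Y) - integral {0..t} (?p X)) = 0"
      unfolding D c_def by (simp add: power2_eq_square power3_eq_cube algebra_simps)
    ultimately show "(g has_real_derivative 0) (at_right t)" by simp
  qed
  moreover have "(y - x) + integral {0..T} (?p Y) - integral {0..T} (?p X) = Y T - X T"
    using solves_sde_integral(2)[OF X(1) T] solves_sde_integral(2)[OF Y(1) T]
    by simp
  ultimately have "(Y T - X T) * exp (- integral {0..T} c) = y - x"
    by (simp add: g_def)
  then show "Y T - X T = (y - x) * exp (integral {0..T} c)"
    by (metis exp_minus_inverse mult.assoc mult.commute mult.right_neutral)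
qed

lemma solves_sde_difference_bound:
  assumes X: "solves_sde \<beta> \<sigma> w x X" "X \<in> borel_measurable (restrict_space borel {0..})"
    and Y: "solves_sde \<beta> \<sigma> w y Y" "Y \<in> borel_measurable (restrict_space borel {0..})"
    and w: "cadlag w" and T: "0 \<le> T"
  shows "\<bar>Y T - X T\<bar> \<le> \<bar>y - x\<bar> * exp (\<beta> * T)"
proof -
  let ?c = "\<lambda>s. \<beta> - (X s ^ 2 + X s * Y s + Y s ^ 2)"
  have "integral {0..T} ?c \<le> integral {0..T} (\<lambda>_. \<beta>)"
  proof (rule integral_le[OF solves_sde_difference(1)[OF assms]])
    show "?c s \<le> \<beta>" for s using quadratic_form_nonneg[of "X s" "Y s"] by linarith
  qed (rule integrable_const_ivl)
  also have "\<dots> = \<beta> * T" using T by simp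
  finally show ?thesis
    unfolding solves_sde_difference(2)[OF assms] by (simp add: abs_mult mult_left_mono)
qed

text \<open>For \<open>y \<noteq> x\<close> the difference quotient is exactly \<open>exp\<close> of
  the integrated coefficient of the linear difference equation. By the Lipschitz bound in the
  initial value, this coefficient converges uniformly on \<open>{0..T}\<close> as \<open>y\<close>
  tends to \<open>x\<close>.\<close>

lemma solution_flow_derivative:
  assumes sol: "\<And>y. solves_sde \<beta> \<sigma> w y (X y)"
    and meas: "\<And>y. X y \<in> borel_measurable (restrict_space borel {0..})"
    and w: "cadlag w" and T: "0 \<le> T"
  shows "(\<lambda>s. \<beta> - 3 * X x s ^ 2) integrable_on {0..T}"
    and "((\<lambda>y. X y T) has_real_derivative exp (integral {0..T} (\<lambda>s. \<beta> - 3 * X x s ^ 2))) (at x)"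
proof -
  let ?c = "\<lambda>y s. \<beta> - (X x s ^ 2 + X x s * X y s + X y s ^ 2)"
  note diff = solves_sde_difference[OF sol meas sol meas w T]
  have cx: "?c x = (\<lambda>s. \<beta> - 3 * X x s ^ 2)" by (auto simp: power2_eq_square)
  show int: "(\<lambda>s. \<beta> - 3 * X x s ^ 2) integrable_on {0..T}"
    using diff(1)[of x x] unfolding cx .
  obtain K where K: "\<And>s. s \<in> {0..T} \<Longrightarrow> \<bar>X x s\<bar> \<le> K" using solves_sde_bounded[OF sol w T] by blast
  \<comment> \<open>The absolute value gives one Lipschitz constant for all times up to
    \<open>T\<close> and either sign of \<beta>.\<close>
  define L where "L = exp (\<bar>\<beta>\<bar> * T)"
  have L: "\<bar>X y s - X x s\<bar> \<le> L * \<bar>y - x\<bar>" if s: "s \<in> {0..T}" for y s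
  proof -
    have "\<beta> * s \<le> \<bar>\<beta>\<bar> * T" using s by (intro mult_mono) auto
    then have "exp (\<beta> * s) \<le> L" by (simp add: L_def)
    moreover have "\<bar>X y s - X x s\<bar> \<le> \<bar>y - x\<bar> * exp (\<beta> * s)"
      using s by (intro solves_sde_difference_bound[OF sol meas sol meas w]) auto
    ultimately show ?thesis by (smt (verit) abs_ge_zero mult.commute mult_left_mono)
  qed
  have "((\<lambda>y. integral {0..T} (?c y)) \<longlongrightarrow> integral {0..T} (?c x)) (at x)"
  proof (rule metric_tendsto_imp_tendsto)
    \<comment> \<open>The majorant comes from factoring \<open>?c y s - ?c x s\<close>, up to sign,
      into \<open>X y s - X x s\<close> and \<open>X y s + 2 * X x s\<close>.\<close>
    show "((\<lambda>y. L * \<bar>y - x\<bar> * (3 * K + L * \<bar>y - x\<bar>) * T) \<longlongrightarrow> 0) (at x)"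
      by (rule tendsto_eq_intros refl | simp)+
    have "dist (integral {0..T} (?c y)) (integral {0..T} (?c x))
        \<le> dist (L * \<bar>y - x\<bar> * (3 * K + L * \<bar>y - x\<bar>) * T) 0" for y
    proof -
      have b: "norm (?c y s - ?c x s) \<le> L * \<bar>y - x\<bar> * (3 * K + L * \<bar>y - x\<bar>)" if s: "s \<in> {0..T}" for s
      proof -
        have "?c y s - ?c x s = - ((X y s - X x s) * (X y s + 2 * X x s))"
          by (simp add: power2_eq_square algebra_simps)
        then have "norm (?c y s - ?c x s) = \<bar>X y s - X x s\<bar> * \<bar>X y s + 2 * X x s\<bar>"
          by (simp add: abs_mult)
        moreover have "\<bar>X y s + 2 * X x s\<bar> \<le> 3 * K + L * \<bar>y - x\<bar>"
          using L[OF s, of y] K[OF s] by linarith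
        ultimately show ?thesis
          using L[OF s, of y] mult_mono[of "\<bar>X y s - X x s\<bar>" "L * \<bar>y - x\<bar>"
              "\<bar>X y s + 2 * X x s\<bar>" "3 * K + L * \<bar>y - x\<bar>"] by linarith
      qed
      have "norm (integral {0..T} (\<lambda>s. ?c y s - ?c x s))
          \<le> integral {0..T} (\<lambda>s. L * \<bar>y - x\<bar> * (3 * K + L * \<bar>y - x\<bar>))"
        by (rule integral_norm_bound_integral)
          (rule Henstock_Kurzweil_Integration.integrable_diff diff(1) integrable_const_ivl b | assumption)+
      moreover have "integral {0..T} (\<lambda>s. ?c y s - ?c x s) = integral {0..T} (?c y) - integral {0..T} (?c x)"
        by (rule Henstock_Kurzweil_Integration.integral_diff) (rule diff(1))+
      moreover have "integral {0..T} (\<lambda>s. L * \<bar>y - x\<bar> * (3 * K + L * \<bar>y - x\<bar>))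
          = L * \<bar>y - x\<bar> * (3 * K + L * \<bar>y - x\<bar>) * T"
        using T by simp
      ultimately have "dist (integral {0..T} (?c y)) (integral {0..T} (?c x))
          \<le> L * \<bar>y - x\<bar> * (3 * K + L * \<bar>y - x\<bar>) * T"
        by (simp only: dist_norm)
      also have "\<dots> \<le> dist (L * \<bar>y - x\<bar> * (3 * K + L * \<bar>y - x\<bar>) * T) 0"
        by (simp only: dist_real_def diff_0_right abs_ge_self)
      finally show ?thesis .
    qed
    then show "\<forall>\<^sub>F y in at x. dist (integral {0..T} (?c y)) (integral {0..T} (?c x))
        \<le> dist (L * \<bar>y - x\<bar> * (3 * K + L * \<bar>y - x\<bar>) * T) 0" by simp
  qed
  then have lim: "((\<lambda>y. exp (integral {0..T} (?c y))) \<longlongrightarrow> exp (integral {0..T} (?c x))) (at x)"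
    by (rule tendsto_exp)
  have "\<forall>\<^sub>F y in at x. exp (integral {0..T} (?c y)) = (X y T - X x T) / (y - x)"
    unfolding eventually_at_filter using diff(2) by simp
  with lim have "((\<lambda>y. (X y T - X x T) / (y - x)) \<longlongrightarrow> exp (integral {0..T} (?c x))) (at x)"
    by (rule Lim_transform_eventually)
  then show "((\<lambda>y. X y T) has_real_derivative exp (integral {0..T} (\<lambda>s. \<beta> - 3 * X x s ^ 2))) (at x)"
    unfolding has_field_derivative_iff cx .
qed

section \<open>Steering all solutions simultaneously\<close>

text \<open>Here \<open>D + e\<close> is the difference between a solution and the target
  \<open>Y\<close>, with \<open>D\<close> continuous and \<open>e\<close> a small error that may
  jump. On \<open>{0..S}\<close> the strong contraction brings \<open>D\<close> below
  \<open>2 * \<epsilon>\<close> from any height; afterwards \<open>Y\<close> is arbitrary and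
  \<open>D\<close> grows at most at rate \<open>2 * \<beta>\<close>.\<close>

lemma tracking_upper:
  fixes D e Y :: "real \<Rightarrow> real"
  assumes "\<beta> > 0" "\<epsilon> > 0" and S: "8 / \<epsilon>^2 \<le> S" and "0 \<le> R"
    and cont: "continuous_on {0..S+R} D"
    and e: "\<And>t. 0 \<le> t \<Longrightarrow> t \<le> S + R \<Longrightarrow> \<bar>e t\<bar> \<le> \<epsilon>"
    and Y: "\<And>t. 0 \<le> t \<Longrightarrow> t < S \<Longrightarrow> 8 * \<beta> \<le> 3 * Y t ^ 2"
    and der: "\<And>t. 0 \<le> t \<Longrightarrow> t < S + R \<Longrightarrow> (D has_real_derivative
       (D t + e t) * (\<beta> - (3 * Y t ^ 2 + 3 * Y t * (D t + e t) + (D t + e t)^2))) (at_right t)"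
    and t: "S \<le> t" "t \<le> S + R"
  shows "D t \<le> 2 * \<epsilon> * exp (2 * \<beta> * (t - S))"
proof -
  let ?d = "\<lambda>t. (D t + e t) * (\<beta> - (3 * Y t ^ 2 + 3 * Y t * (D t + e t) + (D t + e t)^2))"
  have "0 < 8 / \<epsilon>^2" using \<open>\<epsilon> > 0\<close> by simp
  then have "S > 0" using S by linarith
  \<comment> \<open>Coming down from infinity: at most this speed, whatever the height.\<close>
  have fast: "?d t \<le> - (D t ^ 3) / 64" if t: "0 \<le> t" "t < S" and D: "D t > 2 * \<epsilon>" for t
  proof -
    define E where "E = D t + e t"
    have E: "E \<ge> D t / 2" "E > 0" using e[of t] t D \<open>0 \<le> R\<close> \<open>\<epsilon> > 0\<close> by (auto simp: E_def abs_le_iff)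
    \<comment> \<open>Two completions of the square: the quadratic form dominates both
      \<open>E^2 / 4\<close> and \<open>3 * Y t ^ 2 / 4 \<ge> 2 * \<beta>\<close>, hence also their
      mean, which is at least \<open>E^2 / 8 + \<beta>\<close>.\<close>
    have "3 * Y t ^ 2 + 3 * Y t * E + E^2 = 3 * (Y t + E/2)^2 + E^2/4"
      by (simp add: power2_eq_square field_simps)
    moreover have "3 * Y t ^ 2 + 3 * Y t * E + E^2 = (E + 3 * Y t / 2)^2 + 3 * Y t ^ 2 / 4"
      by (simp add: power2_eq_square field_simps)
    moreover have "(Y t + E/2)^2 \<ge> 0" "(E + 3 * Y t / 2)^2 \<ge> 0" by simp_all
    ultimately have "\<beta> - (3 * Y t ^ 2 + 3 * Y t * E + E^2) \<le> - (E^2 / 8)"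
      using Y[OF t] by linarith
    then have "?d t \<le> E * - (E^2 / 8)"
      unfolding E_def[symmetric] using E(2) by (intro mult_left_mono) auto
    also have "\<dots> = - (E ^ 3) / 8" by (simp add: power3_eq_cube power2_eq_square)
    also have "\<dots> \<le> - ((D t / 2) ^ 3) / 8"
      using power_mono[OF E(1), of 3] D \<open>\<epsilon> > 0\<close> by simp
    also have "\<dots> = - (D t ^ 3) / 64" by (simp add: power_divide)
    finally show ?thesis .
  qed
  have start: "D S \<le> 2 * \<epsilon>"
  proof (rule ccontr)
    assume DS: "\<not> D S \<le> 2 * \<epsilon>"
    \<comment> \<open>The level \<open>2 * \<epsilon>\<close> is a barrier that is not crossed
      upwards before \<open>S\<close>. If \<open>D S\<close> lies above it, so does \<open>D\<close>
      on all of \<open>{0..S}\<close>.\<close>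
    have above: "D t > 2 * \<epsilon>" if t: "0 \<le> t" "t \<le> S" for t
    proof (rule ccontr)
      assume "\<not> D t > 2 * \<epsilon>"
      moreover have "continuous_on {t..S} D"
        by (rule continuous_on_subset[OF cont]) (use t \<open>0 \<le> R\<close> in auto)
      moreover have "\<exists>d\<le>0. (D has_real_derivative d) (at_right s)"
        if "t \<le> s" "s < S" "D s > 2 * \<epsilon>" for s
      proof (intro exI conjI)
        have "D s ^ 3 > 0" using that \<open>\<epsilon> > 0\<close> by (intro zero_less_power) linarith
        then show "?d s \<le> 0" using fast[of s] that t by linarith
        show "(D has_real_derivative ?d s) (at_right s)" using that t \<open>0 \<le> R\<close> by (intro der) auto
      qed
      ultimately have "D S \<le> 2 * \<epsilon>" using t by (intro right_derivative_barrier[of t S D]) auto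
      then show False using DS by simp
    qed
    have pos: "D t > 0" if "0 \<le> t" "t \<le> S" for t using above[OF that] \<open>\<epsilon> > 0\<close> by linarith
    \<comment> \<open>Along \<open>d' = - d^3 / 64\<close> the quantity \<open>1 / d^2\<close> grows
      at rate \<open>1 / 32\<close>; the inequality for \<open>D\<close> makes \<open>V\<close>
      nonincreasing. The resulting bound on \<open>D S\<close> is independent of \<open>D 0\<close>,
      and \<open>8 / \<epsilon>^2\<close> is the time by which it reaches
      \<open>2 * \<epsilon>\<close>.\<close>
    define V where "V t = t / 32 - 1 / D t ^ 2" for t
    have "V S \<le> V 0"
    proof (rule le_of_right_derivative_nonpos[where f = V])
      show "0 \<le> S" using \<open>S > 0\<close> by simp
      have "continuous_on {0..S} D" by (rule continuous_on_subset[OF cont]) (use \<open>0 \<le> R\<close> in auto)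
      then show "continuous_on {0..S} V"
        unfolding V_def using pos by (intro continuous_intros) (auto simp: less_imp_neq[symmetric] order.strict_implies_not_eq)
      fix t assume t: "0 \<le> t" "t < S"
      have D0: "D t > 0" using pos t by simp
      note dD = der[of t]
      have "(V has_real_derivative 1 / 32 + 2 * ?d t / D t ^ 3) (at_right t)"
        unfolding V_def using D0 t \<open>0 \<le> R\<close>
        by (auto intro!: derivative_eq_intros dD simp: power3_eq_cube power2_eq_square field_simps)
      moreover have "2 * ?d t / D t ^ 3 \<le> 2 * (- (D t ^ 3) / 64) / D t ^ 3"
        using fast[OF t above] t D0 by (intro divide_right_mono mult_left_mono) auto
      moreover have "2 * (- (D t ^ 3) / 64) / D t ^ 3 = - (1/32)" using D0 by simp
      ultimately show "\<exists>d\<le>0. (V has_real_derivative d) (at_right t)"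
        by (intro exI[of _ "1 / 32 + 2 * ?d t / D t ^ 3"]) auto
    qed
    then have "S / 32 \<le> 1 / D S ^ 2 - 1 / D 0 ^ 2" by (simp add: V_def)
    also have "\<dots> < 1 / D S ^ 2" using pos[of 0] \<open>S > 0\<close> by simp
    also have "\<dots> < 1 / (2 * \<epsilon>)^2"
      using DS \<open>\<epsilon> > 0\<close> by (intro divide_strict_left_mono power_strict_mono mult_pos_pos zero_less_power) auto
    also have "\<dots> = (8 / \<epsilon>^2) / 32" by (simp add: power2_eq_square)
    also have "\<dots> \<le> S / 32" using S by simp
    finally show False by simp
  qed
  \<comment> \<open>Discounting at rate \<open>2 * \<beta>\<close> gives a function with barrier
    \<open>2 * \<epsilon>\<close>: above this level \<open>D + e\<close> is at most
    \<open>2 * D\<close>, and the other factor of the derivative is at most \<beta>.\<close>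
  define g where "g t = D t * exp (- (2 * \<beta> * (t - S)))" for t
  have "g t \<le> 2 * \<epsilon>"
  proof (rule right_derivative_barrier[where f = g, OF t(1)])
    show "continuous_on {S..t} g"
      unfolding g_def using t \<open>S > 0\<close>
      by (intro continuous_intros continuous_on_subset[OF cont]) auto
    show "g S \<le> 2 * \<epsilon>" using start by (simp add: g_def)
    fix s assume s: "S \<le> s" "s < t" and gs: "2 * \<epsilon> < g s"
    have "exp (- (2 * \<beta> * (s - S))) \<le> 1" using \<open>\<beta> > 0\<close> s by simp
    moreover have "D s > 0"
      using gs \<open>\<epsilon> > 0\<close> unfolding g_def by (smt (verit) exp_gt_zero mult_nonpos_nonneg)
    ultimately have "g s \<le> D s" by (simp add: g_def mult_le_cancel_left1)
    then have Ds: "D s > 2 * \<epsilon>" using gs by simp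
    have E: "0 < D s + e s" "D s + e s \<le> 2 * D s"
      using e[of s] s t \<open>S > 0\<close> Ds \<open>\<epsilon> > 0\<close> by (auto simp: abs_le_iff)
    have "3 * Y s ^ 2 + 3 * Y s * (D s + e s) + (D s + e s)^2
        = 3 * (Y s + (D s + e s)/2)^2 + (D s + e s)^2/4"
      by (simp add: power2_eq_square field_simps)
    moreover have "(Y s + (D s + e s)/2)^2 \<ge> 0" "(D s + e s)^2 \<ge> 0" by simp_all
    ultimately have "\<beta> - (3 * Y s ^ 2 + 3 * Y s * (D s + e s) + (D s + e s)^2) \<le> \<beta>" by linarith
    then have "?d s \<le> (D s + e s) * \<beta>" using E(1) by (intro mult_left_mono) auto
    also have "\<dots> \<le> 2 * D s * \<beta>" using E(2) \<open>\<beta> > 0\<close> by (intro mult_right_mono) auto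
    finally have ds: "?d s - 2 * \<beta> * D s \<le> 0" by (simp add: mult.commute mult.left_commute)
    note dD = der[of s]
    have "(g has_real_derivative (?d s - 2 * \<beta> * D s) * exp (- (2 * \<beta> * (s - S)))) (at_right s)"
      unfolding g_def using s t \<open>S > 0\<close>
      by (auto intro!: derivative_eq_intros dD simp: algebra_simps)
    moreover have "(?d s - 2 * \<beta> * D s) * exp (- (2 * \<beta> * (s - S))) \<le> 0"
      using ds by (intro mult_nonpos_nonneg) auto
    ultimately show "\<exists>d\<le>0. (g has_real_derivative d) (at_right s)" by blast
  qed
  then have "g t * exp (2 * \<beta> * (t - S)) \<le> 2 * \<epsilon> * exp (2 * \<beta> * (t - S))" by simp
  moreover have "g t * exp (2 * \<beta> * (t - S)) = D t"
    unfolding g_def mult.assoc by (simp flip: exp_add)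
  ultimately show ?thesis by simp
qed

text \<open>The deviation \<open>X - Y\<close> splits into a continuous part \<open>D\<close>, made
  of the initial difference and the drift integrals, and the noise error \<open>e\<close>. The bound
  is the same for every \<open>x\<close> because the estimate for \<open>D\<close> forgets the
  initial height.\<close>

lemma solution_tracks_target:
  fixes Y :: "real \<Rightarrow> real"
  assumes sol: "solves_sde \<beta> \<sigma> w x X" and w: "cadlag w"
    and "\<beta> > 0" "\<epsilon> > 0" and S: "8 / \<epsilon>^2 \<le> S" and "0 \<le> R"
    and contY: "continuous_on UNIV Y"
    and Y: "\<And>t. 0 \<le> t \<Longrightarrow> t < S \<Longrightarrow> 8 * \<beta> \<le> 3 * Y t ^ 2"
    and noise: "\<And>t. 0 \<le> t \<Longrightarrow> t \<le> S + R \<Longrightarrow>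
      \<bar>\<sigma> * w t - (Y t - Y 0 - integral {0..t} (\<lambda>s. \<beta> * Y s - Y s ^ 3))\<bar> \<le> \<epsilon>"
    and t: "S \<le> t" "t \<le> S + R"
  shows "\<bar>X t - Y t\<bar> \<le> 3 * \<epsilon> * exp (2 * \<beta> * R)"
proof -
  let ?p = "\<lambda>X s. \<beta> * X s - X s ^ 3"
  have "0 < 8 / \<epsilon>^2" using \<open>\<epsilon> > 0\<close> by simp
  then have "S > 0" using S by linarith
  have intY: "?p Y integrable_on {0..t}" for t
    by (intro integrable_continuous_real continuous_intros continuous_on_subset[OF contY]) auto
  define D where "D t = x - Y 0 + integral {0..t} (?p X) - integral {0..t} (?p Y)" for t
  define e where "e t = \<sigma> * w t - (Y t - Y 0 - integral {0..t} (?p Y))" for t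
  have XY: "X t = Y t + (D t + e t)" if "0 \<le> t" for t
    using solves_sde_integral(2)[OF sol that] by (simp add: D_def e_def)
  have contD: "continuous_on {0..S+R} D"
    unfolding D_def
    by (intro continuous_intros indefinite_integral_continuous_1 intY
        solves_sde_integral(1)[OF sol]) (use \<open>S > 0\<close> \<open>0 \<le> R\<close> in auto)
  have e: "\<bar>e t\<bar> \<le> \<epsilon>" if "0 \<le> t" "t \<le> S + R" for t
    using noise[OF that] by (simp add: e_def)
  have der: "(D has_real_derivative
       (D t + e t) * (\<beta> - (3 * Y t ^ 2 + 3 * Y t * (D t + e t) + (D t + e t)^2))) (at_right t)"
    if t: "0 \<le> t" for t
  proof -
    have "((\<lambda>u. integral {0..u} (?p Y)) has_real_derivative ?p Y t) (at_right t)"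
    proof (rule integral_has_right_derivative[OF intY[of "t + 1"]])
      show "continuous (at_right t) (?p Y)"
        by (intro continuous_intros continuous_within_subset[of t UNIV _ "{t<..}"])
          (use contY in \<open>auto simp: continuous_on_eq_continuous_within\<close>)
    qed (use t in auto)
    then have "(D has_real_derivative ?p X t - ?p Y t) (at_right t)"
      unfolding D_def
      by (auto intro!: derivative_eq_intros solves_sde_drift_right_derivative[OF sol w t])
    moreover have "?p X t - ?p Y t
        = (D t + e t) * (\<beta> - (3 * Y t ^ 2 + 3 * Y t * (D t + e t) + (D t + e t)^2))"
      unfolding XY[OF t] by (simp add: power2_eq_square power3_eq_cube algebra_simps)
    ultimately show ?thesis by simp
  qed
  have "D t \<le> 2 * \<epsilon> * exp (2 * \<beta> * (t - S))"
    by (rule tracking_upper[of \<beta> \<epsilon> S R D e Y]) (use assms contD e der in auto)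
  \<comment> \<open>The cubic drift is odd: changing the signs of \<open>D\<close>, \<open>e\<close>
    and \<open>Y\<close> preserves the equation and turns the upper bound into a lower one.\<close>
  moreover have "- D t \<le> 2 * \<epsilon> * exp (2 * \<beta> * (t - S))"
  proof (rule tracking_upper[of \<beta> \<epsilon> S R "\<lambda>t. - D t" "\<lambda>t. - e t" "\<lambda>t. - Y t"])
    fix t :: real assume "0 \<le> t"
    from DERIV_minus[OF der[OF this]]
    show "((\<lambda>t. - D t) has_real_derivative (- D t + - e t) *
         (\<beta> - (3 * (- Y t)\<^sup>2 + 3 * - Y t * (- D t + - e t) + (- D t + - e t)\<^sup>2))) (at_right t)"
      by (simp add: power2_eq_square algebra_simps)
  qed (use assms contD e in \<open>auto intro!: continuous_intros\<close>)
  moreover have "\<bar>X t - Y t\<bar> \<le> \<bar>D t\<bar> + \<bar>e t\<bar>" using XY[of t] t \<open>S > 0\<close> by linarith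
  moreover have "\<bar>e t\<bar> \<le> \<epsilon>" using e t \<open>S > 0\<close> by auto
  moreover have "2 * \<epsilon> * exp (2 * \<beta> * (t - S)) \<le> 2 * \<epsilon> * exp (2 * \<beta> * R)"
    using t \<open>\<beta> > 0\<close> \<open>\<epsilon> > 0\<close> by (intro mult_left_mono) auto
  moreover have "\<epsilon> * 1 \<le> \<epsilon> * exp (2 * \<beta> * R)"
    using \<open>\<beta> > 0\<close> \<open>\<epsilon> > 0\<close> \<open>0 \<le> R\<close> by (intro mult_left_mono) auto
  ultimately show ?thesis by linarith
qed

section \<open>A support theorem for processes with independent increments\<close>

text \<open>This is countable subadditivity. It serves to fix data that depend on the path, such as
  a cell index or a rounded increment, while keeping positive probability.\<close>

lemma (in prob_space) prob_pos_of_countable_cover: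
  assumes "countable I" "\<And>i. i \<in> I \<Longrightarrow> A i \<in> events" "B \<subseteq> (\<Union>i\<in>I. A i)" "prob B > 0"
  shows "\<exists>i\<in>I. prob (A i) > 0"
proof (rule ccontr)
  assume "\<not> ?thesis"
  then have "prob (A i) = 0" if "i \<in> I" for i using that measure_nonneg[of M "A i"] by (metis less_eq_real_def)
  then have "A i \<in> null_sets M" if "i \<in> I" for i
    using assms(2) that by (auto simp: null_sets_def emeasure_eq_measure)
  then have U: "(\<Union>i\<in>I. A i) \<in> null_sets M" by (intro null_sets_UN' assms(1))
  then have "prob B \<le> prob (\<Union>i\<in>I. A i)" using assms(3) by (intro finite_measure_mono) auto
  also have "\<dots> = 0" using U by (simp add: null_sets_def measure_def)
  finally show False using assms(4) by simp
qed

text \<open>Meant for \<open>Z = L - f\<close> with a Levy process \<open>L\<close> and a continuous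
  forcing \<open>f\<close>. Subtracting \<open>f\<close> destroys stationarity in general, so
  stochastic continuity is demanded uniformly on compact intervals. In \<open>kicks\<close> the
  variable \<open>l\<close> stands for the left limit at \<open>u\<close>.\<close>

locale kicked_process = prob_space P for P :: "'w measure" +
  fixes Z :: "real \<Rightarrow> 'w \<Rightarrow> real"
  assumes measurable_Z [measurable]: "Z t \<in> borel_measurable P"
    and right_limit: "\<omega> \<in> space P \<Longrightarrow> ((\<lambda>u. Z u \<omega>) \<longlongrightarrow> Z t \<omega>) (at_right t)"
    and left_limit: "\<omega> \<in> space P \<Longrightarrow> \<exists>l. ((\<lambda>u. Z u \<omega>) \<longlongrightarrow> l) (at_left t)"
    and indep_increments: "mono \<tau> \<Longrightarrow>
      indep_vars (\<lambda>_. borel) (\<lambda>i \<omega>. Z (\<tau> (Suc i)) \<omega> - Z (\<tau> i) \<omega>) {..<n::nat}"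
    and small_increments: "0 < \<rho> \<Longrightarrow> 0 < q \<Longrightarrow> \<exists>d>0. \<forall>s\<in>{a..b}. \<forall>t\<in>{a..b}. \<bar>t - s\<bar> < d \<longrightarrow>
      prob {\<omega> \<in> space P. \<bar>Z t \<omega> - Z s \<omega>\<bar> > \<rho>} < q"
    and kicks: "a < b \<Longrightarrow> 0 < \<bar>z\<bar> \<Longrightarrow> \<bar>z\<bar> < 1 \<Longrightarrow> 0 < \<rho> \<Longrightarrow>
      \<exists>J\<in>events. prob J > 0 \<and> J \<subseteq> space P \<and> (\<forall>\<omega>\<in>J. \<exists>u\<in>{a<..b}. \<forall>l. ((\<lambda>v. Z v \<omega>) \<longlongrightarrow> l) (at_left u) \<longrightarrow>
        \<bar>Z u \<omega> - l - z\<bar> < \<rho>)"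
begin

section \<open>Events of small oscillation\<close>

definition flat :: "real \<Rightarrow> real \<Rightarrow> real \<Rightarrow> 'w set" where
  "flat s t r = {\<omega> \<in> space P. \<forall>u\<in>{s..t}. \<bar>Z u \<omega> - Z s \<omega>\<bar> \<le> r}"

definition flat_grid :: "real \<Rightarrow> real \<Rightarrow> real \<Rightarrow> nat \<Rightarrow> 'w set" where
  "flat_grid s t r k =
     {\<omega> \<in> space P. \<forall>i\<in>{..2^k}. \<bar>Z (s + (t - s) * (real i / 2^k)) \<omega> - Z s \<omega>\<bar> \<le> r}"

lemma flat_grid_event [measurable]: "flat_grid s t r k \<in> events"
  unfolding flat_grid_def by measurable

lemma flat_grid_decseq: "decseq (flat_grid s t r)"
proof (rule decseq_SucI, rule subsetI)
  fix k \<omega> assume w: "\<omega> \<in> flat_grid s t r (Suc k)"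
  have "\<bar>Z (s + (t - s) * (real i / 2^k)) \<omega> - Z s \<omega>\<bar> \<le> r" if "i \<le> 2^k" for i
  proof -
    have "2 * i \<in> {..2^Suc k}" using that by simp
    then have "\<bar>Z (s + (t - s) * (real (2 * i) / 2^Suc k)) \<omega> - Z s \<omega>\<bar> \<le> r"
      using w unfolding flat_grid_def by blast
    then show ?thesis by simp
  qed
  then show "\<omega> \<in> flat_grid s t r k" using w by (auto simp: flat_grid_def)
qed

text \<open>Right continuity carries a strict excess at \<open>u < t\<close> over to all times
  shortly after \<open>u\<close>, among them a dyadic grid point. The end point \<open>t\<close>
  belongs to every grid.\<close>

lemma flat_eq_grid:
  assumes "s \<le> t"
  shows "flat s t r = (\<Inter>k. flat_grid s t r k)"
proof (intro equalityI subsetI)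
  fix \<omega> assume w: "\<omega> \<in> flat s t r"
  have "s + (t - s) * (real i / 2^k) \<in> {s..t}" if "i \<le> 2^k" for i k
  proof -
    have "real i \<le> 2^k" using that by (metis of_nat_le_iff of_nat_numeral of_nat_power)
    then have "real i / 2^k \<le> 1" by simp
    then have "(t - s) * (real i / 2^k) \<le> (t - s) * 1" using assms by (intro mult_left_mono) auto
    then show ?thesis using assms by simp
  qed
  then show "\<omega> \<in> (\<Inter>k. flat_grid s t r k)" using w by (auto simp: flat_def flat_grid_def)
next
  fix \<omega> assume w: "\<omega> \<in> (\<Inter>k. flat_grid s t r k)"
  then have sp: "\<omega> \<in> space P" by (auto simp: flat_grid_def)
  have grid: "\<bar>Z (s + (t - s) * (real i / 2^k)) \<omega> - Z s \<omega>\<bar> \<le> r" if "i \<le> 2^k" for i k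
    using w that by (auto simp: flat_grid_def)
  have "\<bar>Z u \<omega> - Z s \<omega>\<bar> \<le> r" if u: "s \<le> u" "u \<le> t" for u
  proof (cases "u = t")
    case True
    then show ?thesis using grid[of 1 0] by simp
  next
    case False
    with u have ut: "u < t" by simp
    show ?thesis
    proof (rule ccontr)
      assume big: "\<not> ?thesis"
      have "((\<lambda>v. \<bar>Z v \<omega> - Z s \<omega>\<bar>) \<longlongrightarrow> \<bar>Z u \<omega> - Z s \<omega>\<bar>) (at_right u)"
        by (intro tendsto_intros right_limit sp)
      then have "\<forall>\<^sub>F v in at_right u. \<bar>Z v \<omega> - Z s \<omega>\<bar> > r"
        using big by (intro order_tendstoD) auto
      then obtain b where b: "b > u" "\<And>v. u < v \<Longrightarrow> v < b \<Longrightarrow> \<bar>Z v \<omega> - Z s \<omega>\<bar> > r"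
        unfolding eventually_at_right[OF ut] by auto
      obtain k where k: "(t - s) / (b - u) < 2^k"
        using real_arch_pow[of 2 "(t - s) / (b - u)"] by auto
      define y where "y = (u - s) / (t - s) * 2^k"
      have "(u - s) / (t - s) < 1" using u ut by simp
      then have y: "0 \<le> y" "y < 2^k"
        using u ut mult_strict_right_mono[of "(u - s) / (t - s)" 1 "2^k :: real"] by (auto simp: y_def)
      \<comment> \<open>Floor plus one yields a grid point strictly to the right of
        \<open>u\<close>, even if \<open>u\<close> lies on the grid; \<open>y < 2^k\<close> keeps
        the index in range.\<close>
      define i where "i = nat \<lfloor>y\<rfloor> + 1"
      have i: "y < real i" "real i \<le> y + 1" using y by (auto simp: i_def) linarith+
      have "i \<le> 2^k"
      proof -
        have "real (nat \<lfloor>y\<rfloor>) < 2^k" using y by linarith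
        then have "nat \<lfloor>y\<rfloor> < 2^k" by (metis of_nat_less_iff of_nat_numeral of_nat_power)
        then show ?thesis unfolding i_def by linarith
      qed
      define v where "v = s + (t - s) * (real i / 2^k)"
      have uy: "u = s + (t - s) * (y / 2^k)" using ut u by (simp add: y_def)
      have "u < v"
        unfolding v_def by (subst uy) (use i(1) u ut in \<open>auto intro!: mult_strict_left_mono divide_strict_right_mono\<close>)
      moreover have "v \<le> u + (t - s) / 2^k"
      proof -
        have "(t - s) * (real i / 2^k) \<le> (t - s) * ((y + 1) / 2^k)"
          using i(2) u ut by (intro mult_left_mono divide_right_mono) auto
        then show ?thesis unfolding v_def using uy by (simp add: add_divide_distrib distrib_left)
      qed
      moreover have "(t - s) / 2^k < b - u"
        using k b(1) by (simp add: field_simps)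
      ultimately have "\<bar>Z v \<omega> - Z s \<omega>\<bar> > r" by (intro b(2)) auto
      moreover have "\<bar>Z v \<omega> - Z s \<omega>\<bar> \<le> r" unfolding v_def by (rule grid[OF \<open>i \<le> 2^k\<close>])
      ultimately show False by simp
    qed
  qed
  then show "\<omega> \<in> flat s t r" using sp by (auto simp: flat_def)
qed

lemma flat_event [measurable]:
  "flat s t r \<in> events"
proof (cases "s \<le> t")
  case True
  show ?thesis unfolding flat_eq_grid[OF True] by measurable
next
  case False
  then have "flat s t r = space P" by (auto simp: flat_def)
  then show ?thesis by simp
qed

section \<open>Independence over disjoint time intervals\<close>

lemma block_events_indep:
  assumes "mono \<tau>" "K \<inter> L = {}" "K \<subseteq> {..<n}" "L \<subseteq> {..<n}"
    and "S \<in> sets (PiM K (\<lambda>_. borel))" "S' \<in> sets (PiM L (\<lambda>_. borel))"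
  defines "X \<equiv> \<lambda>i \<omega>. Z (\<tau> (Suc i)) \<omega> - Z (\<tau> i) \<omega>"
  shows "prob ({\<omega>\<in>space P. (\<lambda>i\<in>K. X i \<omega>) \<in> S} \<inter> {\<omega>\<in>space P. (\<lambda>i\<in>L. X i \<omega>) \<in> S'})
    = prob {\<omega>\<in>space P. (\<lambda>i\<in>K. X i \<omega>) \<in> S} * prob {\<omega>\<in>space P. (\<lambda>i\<in>L. X i \<omega>) \<in> S'}"
proof -
  have "indep_var (PiM K (\<lambda>_. borel)) (\<lambda>\<omega>. \<lambda>i\<in>K. X i \<omega>) (PiM L (\<lambda>_. borel)) (\<lambda>\<omega>. \<lambda>i\<in>L. X i \<omega>)"
    unfolding X_def by (rule indep_var_restrict[OF indep_increments[OF assms(1)] assms(2-4)])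
  from indep_varD[OF this assms(5,6)]
  show ?thesis by (simp add: vimage_def Int_def conj_commute conj_left_commute)
qed

lemma sum_increments_restrict:
  assumes "{m..<n} \<subseteq> K" "m \<le> (n::nat)"
  shows "(\<Sum>j\<in>{m..<n}. (\<lambda>i\<in>K. Z (\<tau> (Suc i)) \<omega> - Z (\<tau> i) \<omega>) j) = Z (\<tau> n) \<omega> - Z (\<tau> m) \<omega>"
proof -
  have "(\<Sum>j\<in>{m..<n}. (\<lambda>i\<in>K. Z (\<tau> (Suc i)) \<omega> - Z (\<tau> i) \<omega>) j) = (\<Sum>j\<in>{m..<n}. Z (\<tau> (Suc j)) \<omega> - Z (\<tau> j) \<omega>)"
    by (rule sum.cong) (use assms(1) in auto)
  also have "\<dots> = Z (\<tau> n) \<omega> - Z (\<tau> m) \<omega>" using assms(2) by (rule sum_Suc_diff')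
  finally show ?thesis .
qed

lemma sum_components_measurable:
  "{m..<n} \<subseteq> K \<Longrightarrow> (\<lambda>x. \<Sum>j\<in>{m..<n::nat}. x j) \<in> borel_measurable (PiM K (\<lambda>_. borel :: real measure))"
  by (intro borel_measurable_sum measurable_component_singleton) auto

text \<open>One monotone time sequence \<open>\<tau>\<close> runs through the three grids, with
  \<open>n\<close> steps in each interval. Then \<open>A k\<close> depends only on the increments of
  the two outer blocks and \<open>B k\<close> only on those of the middle block.\<close>

lemma grid_events_indep:
  fixes s0 s1 s2 s3 r0 r1 r2 :: real
  assumes s: "s0 \<le> s1" "s1 \<le> s2" "s2 \<le> s3" and C: "C0 \<in> sets borel" "C1 \<in> sets borel"
  defines "A \<equiv> \<lambda>k. {\<omega> \<in> flat_grid s0 s1 r0 k \<inter> flat_grid s2 s3 r2 k.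
      (Z s1 \<omega> - Z s0 \<omega>) + (Z s3 \<omega> - Z s2 \<omega>) \<in> C0}"
    and "B \<equiv> \<lambda>k. {\<omega> \<in> flat_grid s1 s2 r1 k. Z s2 \<omega> - Z s1 \<omega> \<in> C1}"
  shows "prob (A k \<inter> B k) = prob (A k) * prob (B k)"
proof -
  define n :: nat where "n = 2^k"
  have n: "n > 0" "real n = 2^k" by (auto simp: n_def)
  \<comment> \<open>The truncations let three linear pieces run one after another; from
    \<open>3 * n\<close> on the sequence stays at \<open>s3\<close>. Degenerate intervals are
    allowed.\<close>
  define \<tau> where "\<tau> i = s0 + (s1 - s0) * min 1 (real i / n)
    + (s2 - s1) * min 1 (max 0 (real i / n - 1)) + (s3 - s2) * min 1 (max 0 (real i / n - 2))" for i
  have mono: "mono \<tau>"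
  proof (rule monoI)
    fix i j :: nat assume "i \<le> j"
    then have "real i / n \<le> real j / n" by (simp add: divide_right_mono)
    then show "\<tau> i \<le> \<tau> j"
      unfolding \<tau>_def using s by (intro add_mono mult_left_mono min.mono max.mono order.refl) auto
  qed
  have \<tau>0: "\<tau> i = s0 + (s1 - s0) * (real i / 2^k)"
    and \<tau>1: "\<tau> (n + i) = s1 + (s2 - s1) * (real i / 2^k)"
    and \<tau>2: "\<tau> (2 * n + i) = s2 + (s3 - s2) * (real i / 2^k)" if "i \<le> n" for i
  proof -
    have f: "0 \<le> real i / n" "real i / n \<le> 1" using that n by auto
    have e: "real (n + i) / n = 1 + real i / n" "real (2 * n + i) / n = 2 + real i / n"
      using n(1) by (auto simp: field_simps)
    define f where "f = real i / n"
    note f = f[folded f_def] and e = e[folded f_def]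
    have m: "min 1 f = f" "max 0 (f - 1) = 0" "max 0 (f - 2) = 0" "min 1 (1 + f) = 1" "max 0 (1 + f - 1) = f"
      "max 0 (1 + f - 2) = 0" "min 1 (2 + f) = 1" "max 0 (2 + f - 1) = 1 + f" "max 0 (2 + f - 2) = f" "min 1 (0::real) = 0"
      using f by auto
    have f2: "f = real i / 2^k" unfolding f_def n(2) ..
    show "\<tau> i = s0 + (s1 - s0) * (real i / 2^k)"
      unfolding \<tau>_def f_def[symmetric] m f2[symmetric] by simp
    show "\<tau> (n + i) = s1 + (s2 - s1) * (real i / 2^k)"
      unfolding \<tau>_def e m f2[symmetric] by simp
    show "\<tau> (2 * n + i) = s2 + (s3 - s2) * (real i / 2^k)"
      unfolding \<tau>_def e m f2[symmetric] by simp
  qed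
  have ends: "\<tau> 0 = s0" "\<tau> n = s1" "\<tau> (2 * n) = s2" "\<tau> (3 * n) = s3"
    using \<tau>0[of 0] \<tau>1[of 0] \<tau>2[of 0] \<tau>2[of n] n by (auto simp: algebra_simps)
  define K where "K = {0..<n} \<union> {2*n..<3*n}"
  define L where "L = {n..<2*n}"
  \<comment> \<open>Grid values relative to the start of a block are partial sums of increments, so
    the events become measurable sets of increment vectors.\<close>
  define S where "S = {x \<in> space (PiM K (\<lambda>_. borel :: real measure)).
    (\<forall>i\<in>{..n}. \<bar>\<Sum>j\<in>{0..<i}. x j\<bar> \<le> r0 \<and> \<bar>\<Sum>j\<in>{2*n..<2*n+i}. x j\<bar> \<le> r2) \<and>
    (\<Sum>j\<in>{0..<n}. x j) + (\<Sum>j\<in>{2*n..<3*n}. x j) \<in> C0}"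
  define S' where "S' = {x \<in> space (PiM L (\<lambda>_. borel :: real measure)).
    (\<forall>i\<in>{..n}. \<bar>\<Sum>j\<in>{n..<n+i}. x j\<bar> \<le> r1) \<and> (\<Sum>j\<in>{n..<2*n}. x j) \<in> C1}"
  note [measurable] = C
  have S: "S \<in> sets (PiM K (\<lambda>_. borel))"
  proof -
    have "(\<lambda>x. \<Sum>j\<in>{0..<i}. x j) \<in> borel_measurable (PiM K (\<lambda>_. borel :: real measure))"
      "(\<lambda>x. \<Sum>j\<in>{2*n..<2*n+i}. x j) \<in> borel_measurable (PiM K (\<lambda>_. borel :: real measure))" if "i \<in> {..n}" for i
      by (rule sum_components_measurable; use that in \<open>auto simp: K_def\<close>)+
    note * = this
    have "(\<lambda>x. (\<Sum>j\<in>{0..<n}. x j) + (\<Sum>j\<in>{2*n..<3*n}. x j)) \<in> borel_measurable (PiM K (\<lambda>_. borel :: real measure))"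
      by (intro borel_measurable_add sum_components_measurable) (auto simp: K_def)
    then have "{x \<in> space (PiM K (\<lambda>_. borel :: real measure)).
        (\<Sum>j\<in>{0..<n}. x j) + (\<Sum>j\<in>{2*n..<3*n}. x j) \<in> C0} \<in> sets (PiM K (\<lambda>_. borel))"
      by measurable
    moreover have "{x \<in> space (PiM K (\<lambda>_. borel :: real measure)).
        \<bar>\<Sum>j\<in>{0..<i}. x j\<bar> \<le> r0} \<in> sets (PiM K (\<lambda>_. borel))"
      "{x \<in> space (PiM K (\<lambda>_. borel :: real measure)).
        \<bar>\<Sum>j\<in>{2*n..<2*n+i}. x j\<bar> \<le> r2} \<in> sets (PiM K (\<lambda>_. borel))"
      if "i \<in> {..n}" for i
      using *[OF that] by measurable
    ultimately show ?thesis
      unfolding S_def by (intro sets.sets_Collect_conj sets.sets_Collect_finite_All') auto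
  qed
  have S': "S' \<in> sets (PiM L (\<lambda>_. borel))"
  proof -
    have *: "(\<lambda>x. \<Sum>j\<in>{n..<n+i}. x j) \<in> borel_measurable (PiM L (\<lambda>_. borel :: real measure))"
      if "i \<in> {..n}" for i
      by (rule sum_components_measurable; use that in \<open>auto simp: L_def\<close>)
    have "(\<lambda>x. \<Sum>j\<in>{n..<2*n}. x j) \<in> borel_measurable (PiM L (\<lambda>_. borel :: real measure))"
      by (rule sum_components_measurable) (auto simp: L_def)
    then have "{x \<in> space (PiM L (\<lambda>_. borel :: real measure)).
        (\<Sum>j\<in>{n..<2*n}. x j) \<in> C1} \<in> sets (PiM L (\<lambda>_. borel))"
      by measurable
    moreover have "{x \<in> space (PiM L (\<lambda>_. borel :: real measure)).
        \<bar>\<Sum>j\<in>{n..<n+i}. x j\<bar> \<le> r1} \<in> sets (PiM L (\<lambda>_. borel))"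
      if "i \<in> {..n}" for i
      using *[OF that] by measurable
    ultimately show ?thesis
      unfolding S'_def by (intro sets.sets_Collect_conj sets.sets_Collect_finite_All') auto
  qed
  let ?X = "\<lambda>i \<omega>. Z (\<tau> (Suc i)) \<omega> - Z (\<tau> i) \<omega>"
  have A: "A k = {\<omega>\<in>space P. (\<lambda>i\<in>K. ?X i \<omega>) \<in> S}"
  proof -
    have e1: "(\<Sum>j\<in>{0..<i}. (\<lambda>i\<in>K. ?X i \<omega>) j) = Z (s0 + (s1 - s0) * (real i / 2^k)) \<omega> - Z s0 \<omega>"
      "(\<Sum>j\<in>{2*n..<2*n+i}. (\<lambda>i\<in>K. ?X i \<omega>) j) = Z (s2 + (s3 - s2) * (real i / 2^k)) \<omega> - Z s2 \<omega>"
      if "i \<in> {..n}" for i \<omega>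
      using that ends \<tau>0[of i] \<tau>2[of i]
      by (subst sum_increments_restrict; auto simp: K_def)+
    have e2: "(\<Sum>j\<in>{0..<n}. (\<lambda>i\<in>K. ?X i \<omega>) j) = Z s1 \<omega> - Z s0 \<omega>"
      "(\<Sum>j\<in>{2*n..<3*n}. (\<lambda>i\<in>K. ?X i \<omega>) j) = Z s3 \<omega> - Z s2 \<omega>" for \<omega>
      using ends by (subst sum_increments_restrict; auto simp: K_def)+
    show ?thesis
      unfolding A_def S_def flat_grid_def mem_Collect_eq e2 n_def[symmetric]
      using e1 by (auto simp: space_PiM)
  qed
  have B: "B k = {\<omega>\<in>space P. (\<lambda>i\<in>L. ?X i \<omega>) \<in> S'}"
  proof -
    have e1: "(\<Sum>j\<in>{n..<n+i}. (\<lambda>i\<in>L. ?X i \<omega>) j) = Z (s1 + (s2 - s1) * (real i / 2^k)) \<omega> - Z s1 \<omega>"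
      if "i \<in> {..n}" for i \<omega>
      using that ends \<tau>1[of i] by (subst sum_increments_restrict) (auto simp: L_def)
    have e2: "(\<Sum>j\<in>{n..<2*n}. (\<lambda>i\<in>L. ?X i \<omega>) j) = Z s2 \<omega> - Z s1 \<omega>" for \<omega>
      using ends by (subst sum_increments_restrict) (auto simp: L_def)
    show ?thesis
      unfolding B_def S'_def flat_grid_def mem_Collect_eq e2 n_def[symmetric]
      using e1 by (auto simp: space_PiM)
  qed
  show ?thesis
    unfolding A B by (rule block_events_indep[OF mono, of K L "3 * n"])
      (use S S' in \<open>auto simp: K_def L_def\<close>)
qed

text \<open>The product formula passes to the limit of decreasing grid events. Combining both outer
  intervals in one event, with a condition on the total of their increments, prepares for exchanging
  the middle interval.\<close>

lemma flat_events_indep: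
  fixes s0 s1 s2 s3 r0 r1 r2 :: real
  assumes s: "s0 \<le> s1" "s1 \<le> s2" "s2 \<le> s3" and C: "C0 \<in> sets borel" "C1 \<in> sets borel"
  defines "A \<equiv> {\<omega> \<in> flat s0 s1 r0 \<inter> flat s2 s3 r2.
      (Z s1 \<omega> - Z s0 \<omega>) + (Z s3 \<omega> - Z s2 \<omega>) \<in> C0}"
    and "B \<equiv> {\<omega> \<in> flat s1 s2 r1. Z s2 \<omega> - Z s1 \<omega> \<in> C1}"
  shows "prob (A \<inter> B) = prob A * prob B"
proof -
  note [measurable] = C
  define A' where "A' k = {\<omega> \<in> flat_grid s0 s1 r0 k \<inter> flat_grid s2 s3 r2 k.
      (Z s1 \<omega> - Z s0 \<omega>) + (Z s3 \<omega> - Z s2 \<omega>) \<in> C0}" for k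
  define B' where "B' k = {\<omega> \<in> flat_grid s1 s2 r1 k. Z s2 \<omega> - Z s1 \<omega> \<in> C1}" for k
  have AB: "A = (\<Inter>k. A' k)" "B = (\<Inter>k. B' k)" "A \<inter> B = (\<Inter>k. A' k \<inter> B' k)"
    unfolding A_def B_def A'_def B'_def flat_eq_grid[OF s(1)] flat_eq_grid[OF s(2)] flat_eq_grid[OF s(3)]
    by auto
  have eqA: "A' k = flat_grid s0 s1 r0 k \<inter> flat_grid s2 s3 r2 k \<inter>
      {\<omega>\<in>space P. (Z s1 \<omega> - Z s0 \<omega>) + (Z s3 \<omega> - Z s2 \<omega>) \<in> C0}" for k
    by (auto simp: A'_def flat_grid_def)
  have eqB: "B' k = flat_grid s1 s2 r1 k \<inter> {\<omega>\<in>space P. Z s2 \<omega> - Z s1 \<omega> \<in> C1}" for k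
    by (auto simp: B'_def flat_grid_def)
  have meas: "A' k \<in> events" "B' k \<in> events" for k
    unfolding eqA eqB by measurable
  have dec: "decseq A'" "decseq B'" "decseq (\<lambda>k. A' k \<inter> B' k)"
    using decseqD[OF flat_grid_decseq] unfolding A'_def B'_def decseq_def by blast+
  have "(\<lambda>k. prob (A' k \<inter> B' k)) \<longlonglongrightarrow> prob (A \<inter> B)"
    unfolding AB(3) by (rule finite_Lim_measure_decseq) (use meas dec in auto)
  moreover have "(\<lambda>k. prob (A' k) * prob (B' k)) \<longlonglongrightarrow> prob A * prob B"
    unfolding AB(1,2) by (intro tendsto_mult finite_Lim_measure_decseq) (use meas dec in auto)
  moreover have "prob (A' k \<inter> B' k) = prob (A' k) * prob (B' k)" for k
    unfolding A'_def B'_def by (rule grid_events_indep[OF s C])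
  ultimately show ?thesis by (simp add: LIMSEQ_unique)
qed

section \<open>Quiet neighbourhoods and jumps inside small cells\<close>

lemma local_limits:
  assumes "\<omega> \<in> space P" "0 < \<rho>"
  obtains l d where "((\<lambda>u. Z u \<omega>) \<longlongrightarrow> l) (at_left x)" "d > 0"
    "\<And>u. x - d < u \<Longrightarrow> u < x \<Longrightarrow> \<bar>Z u \<omega> - l\<bar> < \<rho>"
    "\<And>u. x \<le> u \<Longrightarrow> u < x + d \<Longrightarrow> \<bar>Z u \<omega> - Z x \<omega>\<bar> < \<rho>"
proof -
  obtain l where l: "((\<lambda>u. Z u \<omega>) \<longlongrightarrow> l) (at_left x)" using left_limit[OF assms(1)] by blast
  note r = right_limit[OF assms(1), of x]
  have "\<forall>\<^sub>F t in at_left x. dist (Z t \<omega>) l < \<rho>" "\<forall>\<^sub>F t in at_right x. dist (Z t \<omega>) (Z x \<omega>) < \<rho>"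
    using tendstoD[OF l assms(2)] tendstoD[OF r assms(2)] by auto
  then obtain d1 d2 where d: "d1 < x" "\<And>t. t > d1 \<Longrightarrow> t < x \<Longrightarrow> dist (Z t \<omega>) l < \<rho>"
    "d2 > x" "\<And>t. t > x \<Longrightarrow> t < d2 \<Longrightarrow> dist (Z t \<omega>) (Z x \<omega>) < \<rho>"
    unfolding eventually_at_left[of "x - 1" x, simplified]
      eventually_at_right[of x "x + 1", simplified] by auto
  show ?thesis
  proof (rule that[OF l])
    show "min (x - d1) (d2 - x) > 0" using d by auto
    show "\<bar>Z u \<omega> - l\<bar> < \<rho>" if "x - min (x - d1) (d2 - x) < u" "u < x" for u
      using d(2)[of u] that by (auto simp: dist_real_def)
    show "\<bar>Z u \<omega> - Z x \<omega>\<bar> < \<rho>" if "x \<le> u" "u < x + min (x - d1) (d2 - x)" for u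
      using d(4)[of u] that assms(2) by (cases "u = x") (auto simp: dist_real_def)
  qed
qed

text \<open>By the one-sided limits a path is quiet on some neighbourhood of \<open>x\<close> unless
  it has a sizable jump at \<open>x\<close>, and stochastic continuity keeps such a jump at a fixed
  time from having positive probability.\<close>

lemma flat_near:
  assumes "0 < \<rho>"
  shows "\<exists>d>0. prob (flat (x - d) (x + d) \<rho>) > 0"
proof -
  define h where "h n = 1 / real (Suc n)" for n
  have h: "h n > 0" for n by (simp add: h_def)
  have h0: "h \<longlonglongrightarrow> 0" unfolding h_def by (rule LIMSEQ_Suc[OF lim_1_over_n])
  define F where "F n = {\<omega> \<in> space P. \<bar>Z x \<omega> - Z (x - h n) \<omega>\<bar> > \<rho> / 4}" for n
  \<comment> \<open>The left summand collects the paths that are quiet at radius \<open>h n\<close>.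
    The right one collects those whose increments up to \<open>x\<close> stay large from index
    \<open>n\<close> on, the trace of a jump at \<open>x\<close>.\<close>
  define A where "A i = (case i of Inl n \<Rightarrow> flat (x - h n) (x + h n) \<rho> | Inr n \<Rightarrow> (\<Inter>m\<in>{n..}. F m))" for i :: "nat + nat"
  have F: "F n \<in> events" for n unfolding F_def by measurable
  have cover: "space P \<subseteq> (\<Union>i\<in>UNIV. A i)"
  proof
    fix \<omega> assume sp: "\<omega> \<in> space P"
    obtain l d where l: "d > 0"
      "\<And>u. x - d < u \<Longrightarrow> u < x \<Longrightarrow> \<bar>Z u \<omega> - l\<bar> < \<rho> / 8"
      "\<And>u. x \<le> u \<Longrightarrow> u < x + d \<Longrightarrow> \<bar>Z u \<omega> - Z x \<omega>\<bar> < \<rho> / 8"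
      using local_limits[OF sp, of "\<rho>/8" x] assms by (metis (no_types, lifting) divide_pos_pos zero_less_numeral)
    have "\<forall>\<^sub>F n in sequentially. h n < d" using h0 l(1) by (rule order_tendstoD)
    then obtain N where N: "\<And>n. n \<ge> N \<Longrightarrow> h n < d" by (auto simp: eventually_sequentially)
    show "\<omega> \<in> (\<Union>i\<in>UNIV. A i)"
    proof (cases "\<bar>Z x \<omega> - l\<bar> \<le> \<rho> / 2")
      case True
      have "\<bar>Z u \<omega> - Z (x - h N) \<omega>\<bar> \<le> \<rho>" if u: "x - h N \<le> u" "u \<le> x + h N" for u
      proof -
        have "\<bar>Z (x - h N) \<omega> - l\<bar> < \<rho> / 8" using l(2)[of "x - h N"] h[of N] N[of N] by auto
        moreover have "\<bar>Z u \<omega> - l\<bar> < \<rho> / 8 \<or> \<bar>Z u \<omega> - Z x \<omega>\<bar> < \<rho> / 8"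
          using l(2,3)[of u] u N[of N] by (cases "u < x") auto
        ultimately show ?thesis using True by linarith
      qed
      then have "\<omega> \<in> A (Inl N)" using sp by (auto simp: A_def flat_def)
      then show ?thesis by blast
    next
      case False
      have "\<omega> \<in> F n" if "n \<ge> N" for n
      proof -
        have "\<bar>Z (x - h n) \<omega> - l\<bar> < \<rho> / 8" using l(2)[of "x - h n"] h[of n] N[OF that] by auto
        then have "\<bar>Z x \<omega> - Z (x - h n) \<omega>\<bar> > \<rho> / 4" using False assms by linarith
        then show ?thesis using sp by (simp add: F_def)
      qed
      then have "\<omega> \<in> A (Inr N)" by (auto simp: A_def)
      then show ?thesis by blast
    qed
  qed
  have "\<exists>i\<in>UNIV. prob (A i) > 0"
  proof (rule prob_pos_of_countable_cover[OF _ _ cover])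
    show "A i \<in> events" for i
      using F by (cases i) (auto simp: A_def intro!: sets.countable_INT'')
  qed (auto simp: prob_space)
  then obtain i where i: "prob (A i) > 0" by blast
  show ?thesis
  proof (cases i)
    case (Inl n)
    then show ?thesis using i h[of n] by (auto simp: A_def)
  next
    \<comment> \<open>This case is contradictory: it bounds the probability of a large increment
      over arbitrarily short intervals from below.\<close>
    case (Inr n)
    obtain d where d: "d > 0" "\<And>s t. s \<in> {x-1..x} \<Longrightarrow> t \<in> {x-1..x} \<Longrightarrow> \<bar>t - s\<bar> < d \<Longrightarrow>
        prob {\<omega> \<in> space P. \<bar>Z t \<omega> - Z s \<omega>\<bar> > \<rho> / 4} < prob (A i)"
      using small_increments[of "\<rho>/4" "prob (A i)" "x - 1" x] assms i by auto
    have "\<forall>\<^sub>F m in sequentially. h m < d" using h0 d(1) by (rule order_tendstoD)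
    then obtain m where m: "m \<ge> n" "h m < d"
      unfolding eventually_sequentially by (meson nle_le)
    have "prob (F m) < prob (A i)"
      unfolding F_def using m(2) h[of m] by (intro d(2)) (auto simp: h_def)
    moreover have "prob (A i) \<le> prob (F m)"
      using Inr m(1) by (intro finite_measure_mono F) (auto simp: A_def)
    ultimately show ?thesis by simp
  qed
qed

text \<open>The time \<open>u\<close> of a jump close to \<open>z\<close> lies in some cell of each
  partition; once the mesh is fine, the one-sided limits at \<open>u\<close> keep the path quiet in
  that cell on either side of the jump. Having this for all large \<open>m\<close> leaves room to
  refine the mesh further.\<close>

lemma kick_in_small_cell:
  assumes "a < b" "0 < \<bar>z\<bar>" "\<bar>z\<bar> < 1" "0 < \<rho>"
  shows "\<exists>m0. \<forall>m\<ge>m0. \<exists>k<m. prob {\<omega> \<in> flat (a + (b-a) * (real k / m)) (a + (b-a) * (real (Suc k) / m)) (\<bar>z\<bar> + \<rho>).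
     \<bar>Z (a + (b-a) * (real (Suc k) / m)) \<omega> - Z (a + (b-a) * (real k / m)) \<omega> - z\<bar> \<le> \<rho>} > 0"
proof -
  define p where "p m k = a + (b-a) * (real k / real m)" for m k
  define G where "G m k = {\<omega> \<in> flat (p m k) (p m (Suc k)) (\<bar>z\<bar> + \<rho>). \<bar>Z (p m (Suc k)) \<omega> - Z (p m k) \<omega> - z\<bar> \<le> \<rho>}" for m k
  have "G m k = flat (p m k) (p m (Suc k)) (\<bar>z\<bar> + \<rho>) \<inter>
      {\<omega> \<in> space P. \<bar>Z (p m (Suc k)) \<omega> - Z (p m k) \<omega> - z\<bar> \<le> \<rho>}" for m k
    by (auto simp: G_def flat_def)
  then have G [measurable]: "G m k \<in> events" for m k by simp
  obtain J where J: "J \<in> events" "prob J > 0" "J \<subseteq> space P" and jump: "\<And>\<omega>. \<omega> \<in> J \<Longrightarrow>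
      \<exists>u\<in>{a<..b}. \<forall>l. ((\<lambda>v. Z v \<omega>) \<longlongrightarrow> l) (at_left u) \<longrightarrow> \<bar>Z u \<omega> - l - z\<bar> < \<rho> / 4"
    using kicks[of a b z "\<rho>/4"] assms by auto
  have cover: "J \<subseteq> (\<Union>m0\<in>UNIV. (\<Inter>m\<in>{m0..}. \<Union>k<m. G m k))"
  proof
    fix \<omega> assume w: "\<omega> \<in> J"
    then have sp: "\<omega> \<in> space P" using J by auto
    obtain u where u: "a < u" "u \<le> b" and ju: "\<And>l. ((\<lambda>v. Z v \<omega>) \<longlongrightarrow> l) (at_left u) \<Longrightarrow> \<bar>Z u \<omega> - l - z\<bar> < \<rho> / 4"
      using jump[OF w] by auto
    obtain l d where ld: "((\<lambda>v. Z v \<omega>) \<longlongrightarrow> l) (at_left u)" "d > 0"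
      "\<And>v. u - d < v \<Longrightarrow> v < u \<Longrightarrow> \<bar>Z v \<omega> - l\<bar> < \<rho> / 8"
      "\<And>v. u \<le> v \<Longrightarrow> v < u + d \<Longrightarrow> \<bar>Z v \<omega> - Z u \<omega>\<bar> < \<rho> / 8"
      using local_limits[OF sp, of "\<rho>/8" u] assms(4) by (metis (no_types, lifting) divide_pos_pos zero_less_numeral)
    note j = ju[OF ld(1)]
    obtain m0 where m0: "(b - a) / d < real m0" using reals_Archimedean2 by blast
    have "\<exists>k<m. \<omega> \<in> G m k" if m: "m \<ge> m0" for m
    proof -
      have "0 < (b - a) / d" using assms(1) ld(2) by simp
      then have mpos: "real m > 0" "(b - a) / d < real m" using m m0 by auto
      then have step: "(b - a) / m < d" using ld(2) by (simp add: field_simps)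
      define y where "y = (u - a) / (b - a) * m"
      have y: "0 < y" "y \<le> m" using u assms(1) mpos by (auto simp: y_def field_simps)
      \<comment> \<open>The ceiling selects the cell that is open on the left and closed on the
        right, so the jump happens after the cell has begun, also if \<open>u\<close> is a grid
        point or equals \<open>b\<close>.\<close>
      define k where "k = nat (\<lceil>y\<rceil> - 1)"
      have k: "real k < y" "y \<le> real (Suc k)" using y by (auto simp: k_def) linarith+
      have km: "k < m" using k(1) y(2) by (metis less_le_trans of_nat_less_iff)
      have uy: "u = a + (b - a) * (y / m)" using assms(1) mpos by (simp add: y_def)
      have pu: "p m k < u" "u \<le> p m (Suc k)"
        unfolding p_def by (subst uy; use assms(1) mpos k in \<open>auto intro!: mult_strict_left_mono mult_left_mono divide_strict_right_mono divide_right_mono\<close>)+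
      have "p m (Suc k) = p m k + (b - a) / m"
        using mpos by (simp add: p_def field_simps)
      then have pd: "u - d < p m k" "p m (Suc k) < u + d" using pu step by linarith+
      have s: "\<bar>Z (p m k) \<omega> - l\<bar> < \<rho> / 8" using pd pu by (intro ld(3)) auto
      have "\<bar>Z v \<omega> - Z (p m k) \<omega>\<bar> \<le> \<bar>z\<bar> + \<rho>" if v: "p m k \<le> v" "v \<le> p m (Suc k)" for v
      proof (cases "v < u")
        case True
        then have "\<bar>Z v \<omega> - l\<bar> < \<rho> / 8" using pd v by (intro ld(3)) auto
        then show ?thesis using s by linarith
      next
        case False
        then have "\<bar>Z v \<omega> - Z u \<omega>\<bar> < \<rho> / 8" using pd v by (intro ld(4)) auto
        then show ?thesis using s j by linarith
      qed
      moreover have "\<bar>Z (p m (Suc k)) \<omega> - Z u \<omega>\<bar> < \<rho> / 8" using pd pu by (intro ld(4)) auto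
      then have "\<bar>Z (p m (Suc k)) \<omega> - Z (p m k) \<omega> - z\<bar> \<le> \<rho>" using s j by linarith
      ultimately show ?thesis using km sp by (auto simp: G_def flat_def)
    qed
    then have "\<omega> \<in> (\<Inter>m\<in>{m0..}. \<Union>k<m. G m k)" by blast
    then show "\<omega> \<in> (\<Union>m0\<in>UNIV. (\<Inter>m\<in>{m0..}. \<Union>k<m. G m k))" by blast
  qed
  \<comment> \<open>Threshold and cell index depend on the path. Two countable covers make them
    deterministic: first \<open>m0\<close>, then \<open>k\<close> for each \<open>m\<close>.\<close>
  have "\<exists>m0\<in>UNIV. prob (\<Inter>m\<in>{m0..}. \<Union>k<m. G m k) > 0"
    by (rule prob_pos_of_countable_cover[OF _ _ cover]) (auto simp: J intro!: sets.countable_INT'')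
  then obtain m0 where m0: "prob (\<Inter>m\<in>{m0..}. \<Union>k<m. G m k) > 0" by blast
  have "\<exists>k\<in>{..<m}. prob (G m k) > 0" if "m \<ge> m0" for m
  proof (rule prob_pos_of_countable_cover[OF _ _ _ m0])
    show "(\<Inter>m\<in>{m0..}. \<Union>k<m. G m k) \<subseteq> (\<Union>k\<in>{..<m}. G m k)" using that by blast
  qed (auto intro: countable_finite)
  then have "\<forall>m\<ge>m0. \<exists>k<m. prob (G m k) > 0" by blast
  then show ?thesis unfolding G_def p_def by blast
qed

text \<open>The excess \<open>\<epsilon>'\<close> over \<open>\<epsilon>\<close> is as small as the final displacement: this makes the property
  transitive in the interval without any loss in \<open>\<epsilon>\<close>.\<close>

definition returns :: "real \<Rightarrow> real \<Rightarrow> real \<Rightarrow> bool" where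
  "returns \<epsilon> a b \<longleftrightarrow> (\<forall>\<epsilon>'>0. prob {\<omega> \<in> flat a b (\<epsilon> + \<epsilon>'). \<bar>Z b \<omega> - Z a \<omega>\<bar> \<le> \<epsilon>'} > 0)"

lemma flat_end_event [measurable]:
  "{\<omega> \<in> flat a b r. \<bar>Z t \<omega> - Z s \<omega> - z\<bar> \<le> \<rho>} \<in> events"
  "{\<omega> \<in> flat a b r. \<bar>Z t \<omega> - Z s \<omega>\<bar> \<le> \<rho>} \<in> events"
proof -
  have "{\<omega> \<in> flat a b r. \<bar>Z t \<omega> - Z s \<omega> - z\<bar> \<le> \<rho>}
      = flat a b r \<inter> {\<omega> \<in> space P. \<bar>Z t \<omega> - Z s \<omega> - z\<bar> \<le> \<rho>}" for z
    by (auto simp: flat_def)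
  then have "{\<omega> \<in> flat a b r. \<bar>Z t \<omega> - Z s \<omega> - z\<bar> \<le> \<rho>} \<in> events" for z by simp
  from this[of z] this[of 0]
  show "{\<omega> \<in> flat a b r. \<bar>Z t \<omega> - Z s \<omega> - z\<bar> \<le> \<rho>} \<in> events"
    "{\<omega> \<in> flat a b r. \<bar>Z t \<omega> - Z s \<omega>\<bar> \<le> \<rho>} \<in> events" by simp_all
qed

lemma flat_trivial: "0 \<le> r \<Longrightarrow> flat s s r = space P"
  by (auto simp: flat_def)

text \<open>Independence allows both returns to happen together. Deviations after \<open>b\<close>
  are measured from \<open>Z b\<close>, which is off \<open>Z a\<close> by at most
  \<open>\<epsilon>' / 2\<close>; this shift is absorbed by the excess, so \<epsilon> is
  unchanged.\<close>

lemma returns_trans: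
  assumes "a \<le> b" "b \<le> c" "returns \<epsilon> a b" "returns \<epsilon> b c"
  shows "returns \<epsilon> a c"
  unfolding returns_def
proof (intro allI impI)
  fix \<epsilon>' :: real assume "\<epsilon>' > 0"
  define \<delta> where "\<delta> = \<epsilon>' / 2"
  have d: "\<delta> > 0" using \<open>\<epsilon>' > 0\<close> by (simp add: \<delta>_def)
  \<comment> \<open>The third interval of the independence lemma is the degenerate
    \<open>{c..c}\<close>, on which flatness is trivial and the increment is zero.\<close>
  let ?A = "{\<omega> \<in> flat a b (\<epsilon> + \<delta>) \<inter> flat c c 0. (Z b \<omega> - Z a \<omega>) + (Z c \<omega> - Z c \<omega>) \<in> {-\<delta>..\<delta>}}"
  let ?B = "{\<omega> \<in> flat b c (\<epsilon> + \<delta>). Z c \<omega> - Z b \<omega> \<in> {-\<delta>..\<delta>}}"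
  have A: "?A = {\<omega> \<in> flat a b (\<epsilon> + \<delta>). \<bar>Z b \<omega> - Z a \<omega>\<bar> \<le> \<delta>}"
    by (auto simp: flat_trivial flat_def[of a b] abs_le_iff)
  have B: "?B = {\<omega> \<in> flat b c (\<epsilon> + \<delta>). \<bar>Z c \<omega> - Z b \<omega>\<bar> \<le> \<delta>}"
    by (auto simp: abs_le_iff)
  have "prob (?A \<inter> ?B) = prob ?A * prob ?B"
    by (rule flat_events_indep) (use assms in auto)
  also have "\<dots> > 0"
    unfolding A B using assms(3,4) d by (simp add: returns_def)
  also have "prob (?A \<inter> ?B) \<le> prob {\<omega> \<in> flat a c (\<epsilon> + \<epsilon>'). \<bar>Z c \<omega> - Z a \<omega>\<bar> \<le> \<epsilon>'}"
  proof (rule finite_measure_mono, rule subsetI)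
    fix \<omega> assume w: "\<omega> \<in> ?A \<inter> ?B"
    have e: "\<bar>Z b \<omega> - Z a \<omega>\<bar> \<le> \<delta>" "\<bar>Z c \<omega> - Z b \<omega>\<bar> \<le> \<delta>" using w A B by auto
    have "\<bar>Z u \<omega> - Z a \<omega>\<bar> \<le> \<epsilon> + \<epsilon>'" if u: "a \<le> u" "u \<le> c" for u
    proof (cases "u \<le> b")
      case True
      then have "\<bar>Z u \<omega> - Z a \<omega>\<bar> \<le> \<epsilon> + \<delta>" using w u by (auto simp: flat_def)
      then show ?thesis using \<open>\<epsilon>' > 0\<close> by (simp add: \<delta>_def)
    next
      case False
      then have "\<bar>Z u \<omega> - Z b \<omega>\<bar> \<le> \<epsilon> + \<delta>" using w u by (auto simp: flat_def)
      then show ?thesis using e(1) \<delta>_def by linarith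
    qed
    then show "\<omega> \<in> {\<omega> \<in> flat a c (\<epsilon> + \<epsilon>'). \<bar>Z c \<omega> - Z a \<omega>\<bar> \<le> \<epsilon>'}"
      using w e \<delta>_def by (auto simp: flat_def)
  qed measurable
  finally show "prob {\<omega> \<in> flat a c (\<epsilon> + \<epsilon>'). \<bar>Z c \<omega> - Z a \<omega>\<bar> \<le> \<epsilon>'} > 0" .
qed

text \<open>With positive probability the process is quiet near \<open>x\<close>, but it may end at
  \<open>b\<close> displaced by some \<open>y\<close>. A very short cell is replaced by an
  independent one with a kick close to \<open>-y\<close>, which cancels the displacement up to a few
  multiples of the tolerance \<open>\<eta>\<close>.\<close>

lemma returns_local:
  assumes "0 < \<epsilon>" "\<epsilon> \<le> 1"
  shows "\<exists>d>0. \<forall>a b. a \<le> x \<and> x \<le> b \<and> b - a < d \<longrightarrow> returns \<epsilon> a b"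
proof -
  obtain d where d: "d > 0" and quiet: "prob (flat (x - d) (x + d) (\<epsilon> / 8)) > 0"
    using flat_near[of "\<epsilon>/8" x] assms by auto
  have "prob {\<omega> \<in> flat a b (\<epsilon> + \<epsilon>'). \<bar>Z b \<omega> - Z a \<omega>\<bar> \<le> \<epsilon>'} > 0"
    if ab: "a \<le> x" "x \<le> b" "b - a < d" and "\<epsilon>' > 0" for a b \<epsilon>'
  proof (cases "a = b")
    case True
    have "{\<omega> \<in> flat a b (\<epsilon> + \<epsilon>'). \<bar>Z b \<omega> - Z a \<omega>\<bar> \<le> \<epsilon>'} = space P"
      using True assms \<open>\<epsilon>' > 0\<close> by (auto simp: flat_def)
    then show ?thesis by (simp add: prob_space)
  next
    case False
    then have "a < b" using ab by simp
    define \<eta> where "\<eta> = min \<epsilon> \<epsilon>' / 16"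
    have eta: "\<eta> > 0" "16 * \<eta> \<le> \<epsilon>" "16 * \<eta> \<le> \<epsilon>'" using assms \<open>\<epsilon>' > 0\<close> by (auto simp: \<eta>_def)
    \<comment> \<open>Quiet paths are sorted by their rounded increment over \<open>{a..b}\<close>.
      One of these countably many classes has positive probability, which fixes the displacement
      \<open>y\<close>.\<close>
    define Q where "Q j = {\<omega> \<in> flat (x - d) (x + d) (\<epsilon> / 8). \<bar>Z b \<omega> - Z a \<omega> - real_of_int j * \<eta>\<bar> \<le> \<eta>}" for j
    have "\<exists>j\<in>UNIV. prob (Q j) > 0"
    proof (rule prob_pos_of_countable_cover[OF _ _ _ quiet])
      show "flat (x - d) (x + d) (\<epsilon> / 8) \<subseteq> (\<Union>j\<in>UNIV. Q j)"
      proof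
        fix \<omega> assume w: "\<omega> \<in> flat (x - d) (x + d) (\<epsilon> / 8)"
        define j where "j = \<lfloor>(Z b \<omega> - Z a \<omega>) / \<eta>\<rfloor>"
        have "j \<le> (Z b \<omega> - Z a \<omega>) / \<eta>" "(Z b \<omega> - Z a \<omega>) / \<eta> < j + 1" unfolding j_def by linarith+
        then have "j * \<eta> \<le> Z b \<omega> - Z a \<omega>" "Z b \<omega> - Z a \<omega> < j * \<eta> + \<eta>"
          using eta(1) by (simp_all add: field_simps)
        then have "\<omega> \<in> Q j" using w by (simp add: Q_def)
        then show "\<omega> \<in> (\<Union>j\<in>UNIV. Q j)" by blast
      qed
    qed (auto simp: Q_def)
    then obtain j where j: "prob (Q j) > 0" by blast
    define y where "y = real_of_int j * \<eta>"
    have osc: "\<bar>Z u \<omega> - Z v \<omega>\<bar> \<le> \<epsilon> / 4" if "\<omega> \<in> Q j" "u \<in> {a..b}" "v \<in> {a..b}" for u v \<omega>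
    proof -
      have "u \<in> {x-d..x+d}" "v \<in> {x-d..x+d}" using that ab by auto
      then have "\<bar>Z u \<omega> - Z (x-d) \<omega>\<bar> \<le> \<epsilon> / 8" "\<bar>Z v \<omega> - Z (x-d) \<omega>\<bar> \<le> \<epsilon> / 8"
        using that(1) by (auto simp: Q_def flat_def)
      then show ?thesis by linarith
    qed
    have "Q j \<noteq> {}" using j by auto
    then obtain \<omega>0 where w0: "\<omega>0 \<in> Q j" by blast
    then have "\<bar>Z b \<omega>0 - Z a \<omega>0 - y\<bar> \<le> \<eta>" by (simp add: Q_def y_def)
    moreover have "\<bar>Z b \<omega>0 - Z a \<omega>0\<bar> \<le> \<epsilon> / 4" using osc[OF w0] \<open>a < b\<close> by auto
    ultimately have y: "\<bar>y\<bar> \<le> \<epsilon> / 4 + \<eta>" by linarith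
    \<comment> \<open>Kicks must have nonzero size, so for \<open>y = 0\<close> a kick of the
      tolerated size \<open>\<eta>\<close> is taken.\<close>
    define z where "z = (if y = 0 then \<eta> else - y)"
    have z: "0 < \<bar>z\<bar>" "\<bar>z\<bar> \<le> \<epsilon> / 4 + \<eta>" "\<bar>z\<bar> < 1" "\<bar>y + z\<bar> \<le> \<eta>"
      using y eta assms by (auto simp: z_def)
    obtain m0 where m0: "\<And>m. m \<ge> m0 \<Longrightarrow> \<exists>k<m. prob {\<omega> \<in> flat (a + (b-a) * (real k / m)) (a + (b-a) * (real (Suc k) / m)) (\<bar>z\<bar> + \<eta>).
        \<bar>Z (a + (b-a) * (real (Suc k) / m)) \<omega> - Z (a + (b-a) * (real k / m)) \<omega> - z\<bar> \<le> \<eta>} > 0"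
      using kick_in_small_cell[OF \<open>a < b\<close> z(1,3) eta(1)] by blast
    \<comment> \<open>Cells shorter than \<open>d'\<close> have an increment above
      \<open>\<eta>\<close> with probability less than that of \<open>Q j\<close>. Hence requiring a
      small increment over the cell cannot exhaust \<open>Q j\<close>.\<close>
    obtain d' where d': "d' > 0" "\<And>s t. s \<in> {a..b} \<Longrightarrow> t \<in> {a..b} \<Longrightarrow> \<bar>t - s\<bar> < d' \<Longrightarrow>
        prob {\<omega> \<in> space P. \<bar>Z t \<omega> - Z s \<omega>\<bar> > \<eta>} < prob (Q j)"
      using small_increments[OF eta(1) j, of a b] by blast
    obtain m1 where m1: "(b - a) / d' < real m1" using reals_Archimedean2 by blast
    define m where "m = max m0 m1"
    have "0 < (b - a) / d'" using d'(1) \<open>a < b\<close> by simp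
    moreover have mm: "real m1 \<le> real m" by (simp add: m_def)
    ultimately have mpos: "real m > 0" using m1 by linarith
    have step: "(b - a) / m < d'"
    proof -
      have "(b - a) / d' < m" using m1 mm by linarith
      then show ?thesis using d'(1) mpos by (simp add: field_simps)
    qed
    obtain k where k: "k < m" and kick0: "prob {\<omega> \<in> flat (a + (b-a) * (real k / m)) (a + (b-a) * (real (Suc k) / m)) (\<bar>z\<bar> + \<eta>).
        \<bar>Z (a + (b-a) * (real (Suc k) / m)) \<omega> - Z (a + (b-a) * (real k / m)) \<omega> - z\<bar> \<le> \<eta>} > 0"
      using m0[of m] by (auto simp: m_def)
    define s where "s = a + (b-a) * (real k / m)"
    define t where "t = a + (b-a) * (real (Suc k) / m)"
    have ts: "t = s + (b - a) / m" using mpos by (simp add: s_def t_def field_simps)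
    have "real (Suc k) / m \<le> 1" using k mpos by simp
    then have "(b - a) * (real (Suc k) / m) \<le> (b - a) * 1" using \<open>a < b\<close> by (intro mult_left_mono) auto
    then have st: "a \<le> s" "s \<le> t" "t \<le> b" "t - s < d'"
      using \<open>a < b\<close> mpos step ts by (auto simp: t_def s_def)
    \<comment> \<open>\<open>?A\<close> is what remains of \<open>Q j\<close> outside the cell; the
      tolerance \<open>2 * \<eta>\<close> pays for the discarded increment over the cell.
      \<open>?B\<close> is the kick inside it.\<close>
    let ?A = "{\<omega> \<in> flat a s (\<epsilon>/4) \<inter> flat t b (\<epsilon>/4). (Z s \<omega> - Z a \<omega>) + (Z b \<omega> - Z t \<omega>) \<in> {y - 2 * \<eta>..y + 2 * \<eta>}}"
    let ?B = "{\<omega> \<in> flat s t (\<bar>z\<bar> + \<eta>). Z t \<omega> - Z s \<omega> \<in> {z - \<eta>..z + \<eta>}}"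
    let ?F = "{\<omega> \<in> space P. \<bar>Z t \<omega> - Z s \<omega>\<bar> > \<eta>}"
    have "?A = flat a s (\<epsilon>/4) \<inter> flat t b (\<epsilon>/4) \<inter>
        {\<omega> \<in> space P. (Z s \<omega> - Z a \<omega>) + (Z b \<omega> - Z t \<omega>) \<in> {y - 2 * \<eta>..y + 2 * \<eta>}}"
      by (auto simp: flat_def)
    then have Aev: "?A \<in> events" by simp
    have "prob ?B > 0"
    proof -
      have "?B = {\<omega> \<in> flat s t (\<bar>z\<bar> + \<eta>). \<bar>Z t \<omega> - Z s \<omega> - z\<bar> \<le> \<eta>}" by (auto simp: abs_le_iff)
      then show ?thesis using kick0 by (simp add: s_def t_def)
    qed
    moreover have "prob ?A > 0"
    proof -
      have Qev: "Q j \<in> events" unfolding Q_def by measurable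
      have sub: "Q j \<subseteq> ?A \<union> ?F"
      proof
        fix \<omega> assume w: "\<omega> \<in> Q j"
        then have sp: "\<omega> \<in> space P" by (auto simp: Q_def flat_def)
        show "\<omega> \<in> ?A \<union> ?F"
        proof (cases "\<bar>Z t \<omega> - Z s \<omega>\<bar> \<le> \<eta>")
          case True
          have "\<omega> \<in> flat a s (\<epsilon>/4)" "\<omega> \<in> flat t b (\<epsilon>/4)"
            using osc[OF w] sp st by (auto simp: flat_def)
          moreover have "\<bar>Z b \<omega> - Z a \<omega> - y\<bar> \<le> \<eta>" using w by (simp add: Q_def y_def)
          then have "\<bar>(Z s \<omega> - Z a \<omega>) + (Z b \<omega> - Z t \<omega>) - y\<bar> \<le> 2 * \<eta>" using True by linarith
          ultimately show ?thesis by (auto simp: abs_le_iff)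
        next
          case False
          then show ?thesis using sp by auto
        qed
      qed
      have "prob (Q j) \<le> prob (?A \<union> ?F)" by (rule finite_measure_mono[OF sub]) (use Aev in measurable)
      also have "\<dots> \<le> prob ?A + prob ?F" by (rule measure_Un_le) (use Aev in measurable)
      finally show ?thesis using d'(2)[of s t] st by auto
    qed
    moreover have "prob (?A \<inter> ?B) = prob ?A * prob ?B"
      by (rule flat_events_indep) (use st in auto)
    ultimately have "0 < prob (?A \<inter> ?B)" by simp
    also have "prob (?A \<inter> ?B) \<le> prob {\<omega> \<in> flat a b (\<epsilon> + \<epsilon>'). \<bar>Z b \<omega> - Z a \<omega>\<bar> \<le> \<epsilon>'}"
    proof (rule finite_measure_mono, rule subsetI)
      fix \<omega> assume w: "\<omega> \<in> ?A \<inter> ?B"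
      then have sp: "\<omega> \<in> space P" by (auto simp: flat_def)
      have e: "\<bar>(Z s \<omega> - Z a \<omega>) + (Z b \<omega> - Z t \<omega>) - y\<bar> \<le> 2 * \<eta>" "\<bar>Z t \<omega> - Z s \<omega> - z\<bar> \<le> \<eta>"
        using w by (auto simp: abs_le_iff)
      have f0: "\<bar>Z u \<omega> - Z a \<omega>\<bar> \<le> \<epsilon> / 4" if "a \<le> u" "u \<le> s" for u
        using w that by (auto simp: flat_def)
      have f1: "\<bar>Z u \<omega> - Z s \<omega>\<bar> \<le> \<bar>z\<bar> + \<eta>" if "s \<le> u" "u \<le> t" for u
        using w that by (auto simp: flat_def)
      have f2: "\<bar>Z u \<omega> - Z t \<omega>\<bar> \<le> \<epsilon> / 4" if "t \<le> u" "u \<le> b" for u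
        using w that by (auto simp: flat_def)
      \<comment> \<open>The height is at most \<open>\<epsilon> / 4\<close> before the cell, gains
        at most \<open>\<epsilon> / 4 + 2 * \<eta>\<close> inside it and
        \<open>\<epsilon> / 4\<close> after it, which stays below \<epsilon> as
        \<open>16 * \<eta> \<le> \<epsilon>\<close>. The final displacement is at most
        \<open>4 * \<eta>\<close>.\<close>
      have "\<bar>Z u \<omega> - Z a \<omega>\<bar> \<le> \<epsilon> + \<epsilon>'" if u: "a \<le> u" "u \<le> b" for u
      proof -
        consider "u \<le> s" | "s \<le> u" "u \<le> t" | "t \<le> u" by linarith
        then show ?thesis
        proof cases
          case 1
          then show ?thesis using f0[of u] u assms \<open>\<epsilon>' > 0\<close> by linarith
        next
          case 2
          then show ?thesis using f0[of s] f1[of u] st z(2) eta assms by linarith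
        next
          case 3
          then show ?thesis using f0[of s] f1[of t] f2[of u] u st z(2) eta assms by linarith
        qed
      qed
      moreover have "\<bar>Z b \<omega> - Z a \<omega>\<bar> \<le> \<epsilon>'" using e z(4) eta by linarith
      ultimately show "\<omega> \<in> {\<omega> \<in> flat a b (\<epsilon> + \<epsilon>'). \<bar>Z b \<omega> - Z a \<omega>\<bar> \<le> \<epsilon>'}"
        using sp by (auto simp: flat_def)
    qed measurable
    finally show ?thesis .
  qed
  then show ?thesis using d unfolding returns_def by blast
qed

text \<open>Since \<open>returns\<close> is stable under concatenation and holds on short intervals
  around every point, the bisection principle \<open>Bolzano\<close> extends it to
  \<open>{a..b}\<close>.\<close>

theorem prob_flat_pos:
  assumes "a \<le> b" "0 < \<epsilon>"
  shows "prob (flat a b \<epsilon>) > 0"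
proof -
  define \<delta> where "\<delta> = min \<epsilon> 1 / 2"
  have d: "0 < \<delta>" "\<delta> \<le> 1" "\<delta> + \<delta> \<le> \<epsilon>" using assms by (auto simp: \<delta>_def)
  have "returns \<delta> a b"
    using assms(1)
    by (rule Bolzano) (use returns_trans returns_local[OF d(1,2)] in blast)+
  then have "0 < prob {\<omega> \<in> flat a b (\<delta> + \<delta>). \<bar>Z b \<omega> - Z a \<omega>\<bar> \<le> \<delta>}"
    using d(1) unfolding returns_def by blast
  also have "\<dots> \<le> prob (flat a b \<epsilon>)"
    using d(3) by (intro finite_measure_mono flat_event) (force simp: flat_def)
  finally show ?thesis .
qed

end

section \<open>Stable processes have kicks of every small size\<close>

text \<open>Positivity of \<open>g\<close> on \<open>0 < \<bar>x\<bar> < 1\<close> is common to the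
  stable density and its truncation.\<close>

lemma emeasure_density_interval_pos:
  fixes g :: "real \<Rightarrow> ennreal"
  assumes g: "g \<in> borel_measurable borel" "\<And>x. 0 < \<bar>x\<bar> \<Longrightarrow> \<bar>x\<bar> < 1 \<Longrightarrow> g x > 0"
    and z: "0 < \<bar>z\<bar>" "\<bar>z\<bar> < 1" "0 < \<rho>"
  shows "emeasure (density lborel g) {z - \<rho><..<z + \<rho>} > 0"
proof (rule ccontr)
  assume "\<not> ?thesis"
  then have "(\<integral>\<^sup>+x. g x * indicator {z - \<rho><..<z + \<rho>} x \<partial>lborel) = 0"
    using g(1) by (simp add: emeasure_density)
  then have ae: "AE x in lborel. g x * indicator {z - \<rho><..<z + \<rho>} x = 0"
    using g(1) by (subst (asm) nn_integral_0_iff_AE) auto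
  \<comment> \<open>A subinterval adjacent to \<open>z\<close> on the side away from the origin
    avoids 0 and stays inside \<open>(-1,1)\<close>.\<close>
  obtain l h where lh: "l < h" "{l<..<h} \<subseteq> {z - \<rho><..<z + \<rho>} \<inter> {x. 0 < \<bar>x\<bar> \<and> \<bar>x\<bar> < 1}"
  proof (cases "z > 0")
    case True
    then show ?thesis using z by (intro that[of z "min (z + \<rho>) 1"]) auto
  next
    case False
    then show ?thesis using z by (intro that[of "max (z - \<rho>) (-1)" z]) auto
  qed
  from ae have "AE x in lborel. x \<notin> {l<..<h}"
  proof eventually_elim
    case (elim x)
    then show ?case using g(2)[of x] lh(2) by (auto simp: indicator_def split: if_splits)
  qed
  then have "emeasure lborel {l<..<h} = 0"
    by (subst (asm) AE_iff_measurable[of "{l<..<h}"]) auto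
  then show False using lh(1) by simp
qed

text \<open>For finite intensity the set is empty with probability
  \<open>exp (- measure \<mu> D)\<close>, which is less than 1. Infinite intensity does occur,
  namely when the interval of jump sizes contains 0.\<close>

lemma poisson_random_measure_nonzero:
  assumes "prob_space P" "poisson_random_measure P N \<mu>" "D \<in> sets \<mu>" "emeasure \<mu> D > 0"
  shows "measure P {\<omega> \<in> space P. emeasure (N \<omega>) D \<noteq> 0} > 0"
proof -
  interpret prob_space P by fact
  have meas [measurable]: "(\<lambda>\<omega>. emeasure (N \<omega>) D) \<in> borel_measurable P"
    using assms(2,3) by (auto simp: poisson_random_measure_def)
  show ?thesis
  proof (cases "emeasure \<mu> D = \<infinity>")
    case True
    then have "AE \<omega> in P. emeasure (N \<omega>) D = \<infinity>"
      using assms(2,3) by (auto simp: poisson_random_measure_def)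
    then have "AE \<omega> in P. emeasure (N \<omega>) D \<noteq> 0" by eventually_elim auto
    then have "prob {\<omega> \<in> space P. emeasure (N \<omega>) D \<noteq> 0} = 1" by (subst prob_Collect_eq_1) auto
    then show ?thesis by simp
  next
    case False
    then have fin: "emeasure \<mu> D < \<infinity>" by (simp add: less_top)
    then have "prob {\<omega> \<in> space P. emeasure (N \<omega>) D = of_nat 0}
        = exp (- measure \<mu> D) * measure \<mu> D ^ 0 / fact 0"
      using assms(2,3) unfolding poisson_random_measure_def by blast
    then have "prob {\<omega> \<in> space P. emeasure (N \<omega>) D = 0} = exp (- measure \<mu> D)" by simp
    moreover have "measure \<mu> D > 0" using fin assms(4) by (simp add: measure_def enn2real_positive_iff)
    ultimately have "prob {\<omega> \<in> space P. emeasure (N \<omega>) D = 0} < 1" by simp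
    moreover have "prob {\<omega> \<in> space P. emeasure (N \<omega>) D \<noteq> 0} = 1 - prob {\<omega> \<in> space P. emeasure (N \<omega>) D = 0}"
      by (rule prob_neg) measurable
    ultimately show ?thesis by simp
  qed
qed

lemma jump_measure_nonzero:
  assumes "emeasure (jump_measure \<omega>) (A \<times> B) \<noteq> 0" "A \<in> sets borel" "B \<in> sets borel"
  shows "\<exists>u\<in>A. jump \<omega> u \<in> B"
proof (rule ccontr)
  assume "\<not> ?thesis"
  then have "(\<lambda>u. (u, jump \<omega> u)) -` (A \<times> B) \<inter> space (count_space {u. jump \<omega> u \<noteq> 0}) = {}" by auto
  moreover have "A \<times> B \<in> sets (borel \<Otimes>\<^sub>M borel)" using assms by auto
  ultimately have "emeasure (jump_measure \<omega>) (A \<times> B) = 0"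
    unfolding jump_measure_def by (subst emeasure_distr) (auto simp: space_pair_measure)
  then show False using assms(1) by simp
qed

lemma stable_const_pos: "0 < \<alpha> \<Longrightarrow> \<alpha> < 2 \<Longrightarrow> stable_const \<alpha> > 0"
  unfolding stable_const_def by (intro mult_pos_pos divide_pos_pos Gamma_real_pos) auto

lemma stable_kicks:
  assumes \<alpha>: "0 < \<alpha>" "\<alpha> < 2" and P: "prob_space P"
    and \<nu>: "\<nu> = stable_levy_measure \<alpha> \<or> \<nu> = truncated_stable_levy_measure \<alpha>"
    and lm: "levy_measure_of \<nu> P"
    and "a < b" "0 < \<bar>z\<bar>" "\<bar>z\<bar> < 1" "0 < \<rho>"
  shows "\<exists>J\<in>sets P. measure P J > 0 \<and> J \<subseteq> space P \<and> (\<forall>\<omega>\<in>J. \<exists>u\<in>{a<..b}. \<bar>jump \<omega> u - z\<bar> < \<rho>)"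
proof -
  define g where "g = (\<lambda>z::real. ennreal (stable_const \<alpha> * \<bar>z\<bar> powr (- 1 - \<alpha>)))"
  define g' where "g' = (if \<nu> = stable_levy_measure \<alpha> then g else (\<lambda>z. g z * indicator {z. \<bar>z\<bar> < 1} z))"
  have g [measurable]: "g \<in> borel_measurable borel" unfolding g_def by measurable
  have g' [measurable]: "g' \<in> borel_measurable borel" unfolding g'_def by (cases "\<nu> = stable_levy_measure \<alpha>") simp_all
  have \<nu>_eq: "\<nu> = density lborel g'"
  proof (cases "\<nu> = stable_levy_measure \<alpha>")
    case True
    then show ?thesis by (simp add: g'_def stable_levy_measure_def g_def)
  next
    case False
    then have "\<nu> = density (density lborel g) (indicator {z. \<bar>z\<bar> < 1})"
      using \<nu> by (simp add: truncated_stable_levy_measure_def stable_levy_measure_def g_def)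
    also have "\<dots> = density lborel (\<lambda>z. g z * indicator {z. \<bar>z\<bar> < 1} z)"
      by (rule density_density_eq) auto
    finally show ?thesis using False by (simp add: g'_def)
  qed
  have pos: "g' x > 0" if "0 < \<bar>x\<bar>" "\<bar>x\<bar> < 1" for x
    using that stable_const_pos[OF \<alpha>] by (auto simp: g'_def g_def)
  \<comment> \<open>A finite-valued density makes \<open>\<nu>\<close> sigma-finite despite its
    infinite mass near 0; the product formula for rectangles relies on this.\<close>
  have "g' x \<noteq> \<infinity>" for x by (auto simp: g'_def g_def indicator_def)
  then interpret \<nu>: sigma_finite_measure \<nu>
    unfolding \<nu>_eq by (subst sigma_finite_measure.sigma_finite_iff_density_finite[OF sigma_finite_lborel]) auto
  let ?D = "{a<..b} \<times> {z - \<rho><..<z + \<rho>}"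
  have sets_\<nu>: "sets \<nu> = sets borel" by (simp add: \<nu>_eq)
  have D: "?D \<in> sets (lborel \<Otimes>\<^sub>M \<nu>)" by (intro pair_measureI) (auto simp: sets_\<nu>)
  have "emeasure (lborel \<Otimes>\<^sub>M \<nu>) ?D = emeasure lborel {a<..b} * emeasure \<nu> {z - \<rho><..<z + \<rho>}"
    by (rule \<nu>.emeasure_pair_measure_Times) (auto simp: sets_\<nu>)
  moreover have "emeasure \<nu> {z - \<rho><..<z + \<rho>} > 0"
    unfolding \<nu>_eq by (rule emeasure_density_interval_pos) (use assms pos in auto)
  ultimately have "emeasure (lborel \<Otimes>\<^sub>M \<nu>) ?D > 0"
    using \<open>a < b\<close> by (simp add: ennreal_zero_less_mult_iff)
  moreover have prm: "poisson_random_measure P jump_measure (lborel \<Otimes>\<^sub>M \<nu>)"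
    using lm by (simp add: levy_measure_of_def)
  ultimately have "measure P {\<omega> \<in> space P. emeasure (jump_measure \<omega>) ?D \<noteq> 0} > 0"
    using P D by (intro poisson_random_measure_nonzero)
  moreover have "{\<omega> \<in> space P. emeasure (jump_measure \<omega>) ?D \<noteq> 0} \<in> sets P"
  proof -
    have [measurable]: "(\<lambda>\<omega>. emeasure (jump_measure \<omega>) ?D) \<in> borel_measurable P"
      using prm D by (auto simp: poisson_random_measure_def)
    show ?thesis by measurable
  qed
  moreover have "\<exists>u\<in>{a<..b}. \<bar>jump \<omega> u - z\<bar> < \<rho>" if nz: "emeasure (jump_measure \<omega>) ?D \<noteq> 0" for \<omega>
  proof -
    obtain u where "u \<in> {a<..b}" "jump \<omega> u \<in> {z - \<rho><..<z + \<rho>}"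
      using jump_measure_nonzero[of \<omega> "{a<..b}" "{z - \<rho><..<z + \<rho>}"] nz by auto
    then show ?thesis by (intro bexI[of _ u]) (auto simp: abs_less_iff)
  qed
  ultimately show ?thesis
    by (intro bexI[of _ "{\<omega> \<in> space P. emeasure (jump_measure \<omega>) ?D \<noteq> 0}"]) auto
qed

section \<open>Levy processes minus a continuous path\<close>

lemma space_levy_process:
  "two_sided_levy_process P \<Longrightarrow> space P = path_space"
  by (simp add: two_sided_levy_process_def canonical_space_def space_restrict_space space_PiM)

lemma coordinate_measurable:
  assumes "two_sided_levy_process P"
  shows "(\<lambda>\<omega>. \<omega> u) \<in> borel_measurable P"
proof -
  have "(\<lambda>\<omega>. \<omega> u) \<in> borel_measurable canonical_space"
    unfolding canonical_space_def
    by (intro measurable_restrict_space1 measurable_component_singleton) simp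
  moreover have "sets P = sets canonical_space" using assms by (simp add: two_sided_levy_process_def)
  ultimately show ?thesis by (simp cong: measurable_cong_sets)
qed

text \<open>Shifting increments by constants keeps them independent, and a continuous
  \<open>f\<close> changes no jump. Uniform stochastic continuity combines stationarity of the noise
  with uniform continuity of \<open>f\<close>.\<close>

lemma levy_kicked_process:
  fixes f :: "real \<Rightarrow> real"
  assumes levy: "two_sided_levy_process P" and f: "continuous_on UNIV f"
    and kicks: "\<And>a b z \<rho>. a < b \<Longrightarrow> 0 < \<bar>z\<bar> \<Longrightarrow> \<bar>z\<bar> < 1 \<Longrightarrow> 0 < \<rho> \<Longrightarrow>
      \<exists>J\<in>sets P. measure P J > 0 \<and> J \<subseteq> space P \<and> (\<forall>\<omega>\<in>J. \<exists>u\<in>{a<..b}. \<bar>jump \<omega> u - z\<bar> < \<rho>)"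
  shows "kicked_process P (\<lambda>u \<omega>. \<omega> u - f u)"
proof -
  interpret prob_space P using levy by (simp add: two_sided_levy_process_def)
  note [measurable] = coordinate_measurable[OF levy]
  have levy_props:
    "\<forall>s t h. distr P borel (\<lambda>\<omega>. \<omega> (t + h) - \<omega> (s + h)) = distr P borel (\<lambda>\<omega>. \<omega> t - \<omega> s)"
    "\<forall>t. \<forall>\<epsilon>>0. ((\<lambda>s. measure P {\<omega> \<in> space P. \<bar>\<omega> s - \<omega> t\<bar> > \<epsilon>}) \<longlongrightarrow> 0) (at t)"
    using levy unfolding two_sided_levy_process_def by blast+
  have cadlag: "cadlag \<omega>" "\<omega> 0 = 0" if "\<omega> \<in> space P" for \<omega>
    using that space_levy_process[OF levy] by (auto simp: path_space_def)
  have flim: "(f \<longlongrightarrow> f t) (at t within A)" for t A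
    using f by (metis UNIV_I continuous_on_def subset_UNIV tendsto_within_subset)
  show ?thesis
  proof
    show "(\<lambda>\<omega>. \<omega> t - f t) \<in> borel_measurable P" for t by measurable
    show "((\<lambda>u. \<omega> u - f u) \<longlongrightarrow> \<omega> t - f t) (at_right t)" if "\<omega> \<in> space P" for \<omega> t
      using cadlag(1)[OF that] by (intro tendsto_diff flim) (auto simp: cadlag_def continuous_within)
    show "\<exists>l. ((\<lambda>u. \<omega> u - f u) \<longlongrightarrow> l) (at_left t)" if "\<omega> \<in> space P" for \<omega> t
      using cadlag(1)[OF that] tendsto_diff[OF _ flim] unfolding cadlag_def by blast
    show "indep_vars (\<lambda>_. borel) (\<lambda>i \<omega>. \<omega> (\<tau> (Suc i)) - f (\<tau> (Suc i)) - (\<omega> (\<tau> i) - f (\<tau> i))) {..<n}"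
      if "mono \<tau>" for \<tau> :: "nat \<Rightarrow> real" and n
    proof -
      have "indep_vars (\<lambda>_. borel) (\<lambda>i \<omega>. \<omega> (\<tau> (Suc i)) - \<omega> (\<tau> i)) {..<n}"
        using levy that by (simp add: two_sided_levy_process_def)
      then have "indep_vars (\<lambda>_. borel)
          (\<lambda>i \<omega>. (\<lambda>x. x - (f (\<tau> (Suc i)) - f (\<tau> i))) (\<omega> (\<tau> (Suc i)) - \<omega> (\<tau> i))) {..<n}"
        by (rule indep_vars_compose2) measurable
      then show ?thesis by (simp add: algebra_simps)
    qed
    show "\<exists>J\<in>events. 0 < prob J \<and> J \<subseteq> space P \<and> (\<forall>\<omega>\<in>J. \<exists>u\<in>{a<..b}.
        \<forall>l. ((\<lambda>v. \<omega> v - f v) \<longlongrightarrow> l) (at_left u) \<longrightarrow> \<bar>\<omega> u - f u - l - z\<bar> < \<rho>)"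
      if "a < b" "0 < \<bar>z\<bar>" "\<bar>z\<bar> < 1" "0 < \<rho>" for a b z \<rho>
    proof -
      have "\<bar>\<omega> u - f u - l - z\<bar> < \<rho>"
        if "\<bar>jump \<omega> u - z\<bar> < \<rho>" "((\<lambda>v. \<omega> v - f v) \<longlongrightarrow> l) (at_left u)" for \<omega> u l
      proof -
        have "((\<lambda>v. (\<omega> v - f v) + f v) \<longlongrightarrow> l + f u) (at_left u)"
          by (intro tendsto_add that(2) flim)
        then have "Lim (at_left u) \<omega> = l + f u" by (intro tendsto_Lim) auto
        then show ?thesis using that(1) by (simp add: jump_def algebra_simps)
      qed
      then show ?thesis using kicks[OF that] by blast
    qed
    show "\<exists>d>0. \<forall>s\<in>{a..b}. \<forall>t\<in>{a..b}. \<bar>t - s\<bar> < d \<longrightarrow>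
        prob {\<omega> \<in> space P. \<bar>\<omega> t - f t - (\<omega> s - f s)\<bar> > \<rho>} < q"
      if "0 < \<rho>" "0 < q" for \<rho> q a b
    proof -
      \<comment> \<open>By stationarity a modulus at time 0 serves all times. Half of
        \<open>\<rho>\<close> is reserved for the increment of \<open>f\<close>.\<close>
      have "((\<lambda>s. prob {\<omega> \<in> space P. \<bar>\<omega> s - \<omega> 0\<bar> > \<rho>/2}) \<longlongrightarrow> 0) (at 0)"
        using levy_props(2)[rule_format, of "\<rho>/2" 0] that(1) by simp
      then have "\<forall>\<^sub>F s in at 0. prob {\<omega> \<in> space P. \<bar>\<omega> s - \<omega> 0\<bar> > \<rho>/2} < q"
        by (rule order_tendstoD(2)) fact
      then obtain d1 where d1: "d1 > 0" "\<And>s. s \<noteq> 0 \<Longrightarrow> \<bar>s\<bar> < d1 \<Longrightarrow>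
          prob {\<omega> \<in> space P. \<bar>\<omega> s - \<omega> 0\<bar> > \<rho>/2} < q"
        unfolding eventually_at by (auto simp: dist_real_def)
      have "uniformly_continuous_on {a..b} f"
        by (intro compact_uniformly_continuous continuous_on_subset[OF f]) auto
      then obtain d2 where d2: "d2 > 0" "\<And>s t. s \<in> {a..b} \<Longrightarrow> t \<in> {a..b} \<Longrightarrow> \<bar>t - s\<bar> < d2 \<Longrightarrow> \<bar>f t - f s\<bar> < \<rho>/2"
        unfolding uniformly_continuous_on_def dist_real_def using half_gt_zero[OF \<open>0 < \<rho>\<close>] by blast
      have "prob {\<omega> \<in> space P. \<bar>\<omega> t - f t - (\<omega> s - f s)\<bar> > \<rho>} < q"
        if st: "s \<in> {a..b}" "t \<in> {a..b}" "\<bar>t - s\<bar> < min d1 d2" for s t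
      proof -
        have "{\<omega> \<in> space P. \<bar>\<omega> t - f t - (\<omega> s - f s)\<bar> > \<rho>} \<subseteq> {\<omega> \<in> space P. \<bar>\<omega> t - \<omega> s\<bar> > \<rho>/2}"
        proof (rule Collect_mono, intro impI conjI; elim conjE)
          fix \<omega> :: "real \<Rightarrow> real" assume "\<rho> < \<bar>\<omega> t - f t - (\<omega> s - f s)\<bar>"
          moreover have "\<bar>f t - f s\<bar> < \<rho> / 2" using d2(2)[OF st(1,2)] st(3) by simp
          ultimately show "\<rho> / 2 < \<bar>\<omega> t - \<omega> s\<bar>" by linarith
        qed
        then have "prob {\<omega> \<in> space P. \<bar>\<omega> t - f t - (\<omega> s - f s)\<bar> > \<rho>} \<le> prob {\<omega> \<in> space P. \<bar>\<omega> t - \<omega> s\<bar> > \<rho>/2}"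
          by (rule finite_measure_mono) measurable
        also have "\<dots> = measure (distr P borel (\<lambda>\<omega>. \<omega> t - \<omega> s)) {x. \<bar>x\<bar> > \<rho>/2}"
          by (subst measure_distr) (auto intro!: arg_cong[where f=prob])
        also have "distr P borel (\<lambda>\<omega>. \<omega> t - \<omega> s) = distr P borel (\<lambda>\<omega>. \<omega> (t + - s) - \<omega> (s + - s))"
          using levy_props(1)[rule_format, of t "- s" s] by simp
        also have "measure \<dots> {x. \<bar>x\<bar> > \<rho>/2} = prob {\<omega> \<in> space P. \<bar>\<omega> (t - s) - \<omega> 0\<bar> > \<rho>/2}"
          by (subst measure_distr) (auto intro!: arg_cong[where f=prob])
        also have "\<dots> < q"
          using d1(2)[of "t - s"] st(3) \<open>0 < \<rho>\<close> \<open>0 < q\<close> by (cases "t = s") auto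
        finally show ?thesis .
      qed
      then show ?thesis using d1(1) d2(1) by (intro exI[of _ "min d1 d2"]) auto
    qed
  qed
qed

section \<open>The random dynamical system\<close>

lemma shift_path_space:
  assumes "\<omega> \<in> path_space"
  shows "shift t \<omega> \<in> path_space"
proof -
  have lim: "((\<lambda>s. \<omega> (t + s)) \<longlongrightarrow> l) (at u within A)"
    if "(\<omega> \<longlongrightarrow> l) (at (t + u) within (+) t ` A)" for l u A
  proof (rule filterlim_compose[OF that])
    show "filterlim ((+) t) (at (t + u) within (+) t ` A) (at u within A)"
      by (auto simp: filterlim_at eventually_at_filter intro!: tendsto_intros)
  qed
  have "x \<in> (+) t ` A \<longleftrightarrow> x - t \<in> A" for x A by (force simp: image_iff)
  then have img: "(+) t ` {u<..} = {t + u<..}" "(+) t ` {..<u} = {..<t + u}" for u by auto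
  have "((\<lambda>s. \<omega> (t + s)) \<longlongrightarrow> \<omega> (t + u)) (at_right u)" for u
    using assms lim[where A="{u<..}" and u=u, unfolded img]
    by (auto simp: path_space_def cadlag_def continuous_within)
  moreover have "\<exists>l. ((\<lambda>s. \<omega> (t + s)) \<longlongrightarrow> l) (at_left u)" for u
  proof -
    obtain l where "(\<omega> \<longlongrightarrow> l) (at_left (t + u))" using assms by (auto simp: path_space_def cadlag_def)
    then show ?thesis using lim[where A="{..<u}" and u=u, unfolded img] by blast
  qed
  ultimately have "cadlag (shift t \<omega>)"
    unfolding cadlag_def shift_def continuous_within using tendsto_diff[OF _ tendsto_const] by fast
  then show ?thesis by (simp add: path_space_def shift_def)
qed

lemma shift_shift: "shift s (shift t \<omega>) = shift (t + s) \<omega>"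
  by (auto simp: shift_def add_ac)

lemma shift_0: "\<omega> \<in> path_space \<Longrightarrow> shift 0 \<omega> = \<omega>"
  by (auto simp: shift_def path_space_def)

locale cubic_sde =
  fixes P :: "(real \<Rightarrow> real) measure" and \<beta> \<sigma> :: real and \<phi>
  assumes levy: "two_sided_levy_process P" and rds: "generated_rds P \<beta> \<sigma> \<phi>"
begin

lemma space_P: "space P = path_space"
  using levy by (rule space_levy_process)

lemma cadlag_path: "\<omega> \<in> space P \<Longrightarrow> cadlag \<omega>"
  by (simp add: space_P path_space_def)

lemma shift_space: "\<omega> \<in> space P \<Longrightarrow> shift t \<omega> \<in> space P"
  by (simp add: space_P shift_path_space)

lemma solution: "\<omega> \<in> space P \<Longrightarrow> solves_sde \<beta> \<sigma> \<omega> x (\<lambda>t. \<phi> t \<omega> x)"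
  using rds by (simp add: generated_rds_def)

lemma cocycle: "\<omega> \<in> space P \<Longrightarrow> 0 \<le> s \<Longrightarrow> 0 \<le> t \<Longrightarrow> \<phi> (s + t) \<omega> x = \<phi> t (shift s \<omega>) (\<phi> s \<omega> x)"
  using rds by (simp add: generated_rds_def random_dynamical_system_def)

lemma flow_measurable:
  "(\<lambda>(t, \<omega>, x). \<phi> t \<omega> x) \<in> borel_measurable (restrict_space borel {0..} \<Otimes>\<^sub>M P \<Otimes>\<^sub>M borel)"
  using rds by (simp add: generated_rds_def random_dynamical_system_def)

lemma solution_measurable:
  assumes "\<omega> \<in> space P"
  shows "(\<lambda>t. \<phi> t \<omega> x) \<in> borel_measurable (restrict_space borel {0..})"
proof -
  have "(\<lambda>t. (t, \<omega>, x)) \<in> restrict_space borel {0..} \<rightarrow>\<^sub>M restrict_space borel {0..} \<Otimes>\<^sub>M P \<Otimes>\<^sub>M borel"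
    using assms by measurable
  from measurable_compose[OF this flow_measurable] show ?thesis by simp
qed

lemma flow_at_random_point_measurable:
  assumes "0 \<le> T" "b \<in> borel_measurable P"
  shows "(\<lambda>\<omega>. \<phi> T \<omega> (b \<omega>)) \<in> borel_measurable P"
proof -
  have "T \<in> space (restrict_space borel {0..})" using assms(1) by (simp add: space_restrict_space)
  then have "(\<lambda>\<omega>. (T, \<omega>, b \<omega>)) \<in> P \<rightarrow>\<^sub>M restrict_space borel {0..} \<Otimes>\<^sub>M P \<Otimes>\<^sub>M borel"
    using assms(2) by measurable
  from measurable_compose[OF this flow_measurable] show ?thesis by simp
qed

lemma flow_has_derivative:
  assumes "\<omega> \<in> space P" "0 \<le> T"
  shows "(\<lambda>s. \<beta> - 3 * \<phi> s \<omega> x ^ 2) integrable_on {0..T}"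
    and "((\<lambda>y. \<phi> T \<omega> y) has_real_derivative exp (integral {0..T} (\<lambda>s. \<beta> - 3 * \<phi> s \<omega> x ^ 2))) (at x)"
  using solution_flow_derivative[of \<beta> \<sigma> \<omega> "\<lambda>y t. \<phi> t \<omega> y" T x]
    solution solution_measurable cadlag_path assms by auto

section \<open>Finite-time Lyapunov exponents\<close>

lemma lyapunov_eq:
  assumes "\<omega> \<in> space P" "0 \<le> T"
  shows "finite_time_lyapunov \<phi> a T \<omega> = 1 / T * integral {0..T} (\<lambda>s. \<beta> - 3 * \<phi> s \<omega> (a \<omega>) ^ 2)"
  using DERIV_imp_deriv[OF flow_has_derivative(2)[OF assms]] by (simp add: finite_time_lyapunov_def)

lemma lyapunov_le:
  assumes "\<omega> \<in> space P" "0 < T"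
  shows "finite_time_lyapunov \<phi> a T \<omega> \<le> \<beta>"
proof -
  have "integral {0..T} (\<lambda>s. \<beta> - 3 * \<phi> s \<omega> (a \<omega>) ^ 2) \<le> integral {0..T} (\<lambda>_. \<beta>)"
    using assms by (intro integral_le flow_has_derivative(1) integrable_const_ivl) auto
  then show ?thesis
    using assms(2) by (simp add: lyapunov_eq[OF assms(1)] field_simps)
qed

text \<open>The derivative at the random point is a limit of difference quotients along
  \<open>h n\<close>, each measurable by joint measurability of the flow.\<close>

lemma lyapunov_measurable:
  assumes "0 \<le> T" and [measurable]: "a \<in> borel_measurable P"
  shows "finite_time_lyapunov \<phi> a T \<in> borel_measurable P"
proof -
  define h where "h n = 1 / real (Suc n)" for n
  have h: "h n \<noteq> 0" for n by (simp add: h_def)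
  have h0: "h \<longlonglongrightarrow> 0" unfolding h_def by (rule LIMSEQ_Suc[OF lim_1_over_n])
  have "(\<lambda>\<omega>. deriv (\<lambda>x. \<phi> T \<omega> x) (a \<omega>)) \<in> borel_measurable P"
  proof (rule borel_measurable_LIMSEQ_real)
    show "(\<lambda>\<omega>. (\<phi> T \<omega> (a \<omega> + h n) - \<phi> T \<omega> (a \<omega>)) / h n) \<in> borel_measurable P" for n
      by (intro borel_measurable_divide borel_measurable_diff flow_at_random_point_measurable assms(1)) measurable
    fix \<omega> assume w: "\<omega> \<in> space P"
    have "((\<lambda>k. (\<phi> T \<omega> (a \<omega> + k) - \<phi> T \<omega> (a \<omega>)) / k) \<longlongrightarrow> deriv (\<lambda>x. \<phi> T \<omega> x) (a \<omega>)) (at 0)"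
      using flow_has_derivative(2)[OF w assms(1), of "a \<omega>"] DERIV_imp_deriv[OF flow_has_derivative(2)[OF w assms(1), of "a \<omega>"]]
      by (simp add: DERIV_def)
    then show "(\<lambda>n. (\<phi> T \<omega> (a \<omega> + h n) - \<phi> T \<omega> (a \<omega>)) / h n) \<longlonglongrightarrow> deriv (\<lambda>x. \<phi> T \<omega> x) (a \<omega>)"
      by (rule filterlim_compose) (use h h0 in \<open>auto simp: filterlim_at\<close>)
  qed
  then show ?thesis unfolding finite_time_lyapunov_def by measurable
qed

lemma lyapunov_pos:
  assumes w: "\<omega> \<in> space P" and "0 < T" and \<eta>: "3 * \<eta>^2 < \<beta>" "0 \<le> \<eta>"
    and small: "\<And>s. 0 \<le> s \<Longrightarrow> s \<le> T \<Longrightarrow> \<bar>\<phi> s \<omega> (a \<omega>)\<bar> \<le> \<eta>"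
  shows "finite_time_lyapunov \<phi> a T \<omega> > 0"
proof -
  have "integral {0..T} (\<lambda>_. \<beta> - 3 * \<eta>^2) \<le> integral {0..T} (\<lambda>s. \<beta> - 3 * \<phi> s \<omega> (a \<omega>) ^ 2)"
  proof (intro integral_le flow_has_derivative(1)[OF w] integrable_const_ivl)
    fix s assume "s \<in> {0..T}"
    then have "\<bar>\<phi> s \<omega> (a \<omega>)\<bar> \<le> \<bar>\<eta>\<bar>" using small[of s] \<eta>(2) by auto
    then have "\<phi> s \<omega> (a \<omega>) ^ 2 \<le> \<eta>^2" by (simp only: abs_le_square_iff)
    then show "\<beta> - 3 * \<eta>^2 \<le> \<beta> - 3 * \<phi> s \<omega> (a \<omega>) ^ 2" by simp
  qed (use assms in auto)
  moreover have "integral {0..T} (\<lambda>_. \<beta> - 3 * \<eta>^2) > 0" using assms by simp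
  ultimately show ?thesis using \<open>0 < T\<close> by (simp add: lyapunov_eq[OF w])
qed

text \<open>Pullback solutions started from 0 converge to \<open>c\<close> at time 0, and continuity
  of the flow carries this to time \<open>s\<close>. Each of them passes time \<open>-r\<close> at
  an uncontrolled point, so the bound has to be uniform in \<open>x\<close>.\<close>

lemma equilibrium_bound:
  assumes w: "\<omega> \<in> space P" and r: "0 \<le> r" and s: "0 \<le> s"
    and lim: "((\<lambda>t. SUP x\<in>{0}. ennreal \<bar>\<phi> t (shift (- t) \<omega>) x - c\<bar>) \<longlongrightarrow> 0) at_top"
    and bound: "\<And>x. \<bar>\<phi> (r + s) (shift (- r) \<omega>) x\<bar> \<le> \<eta>"
  shows "\<bar>\<phi> s \<omega> c\<bar> \<le> \<eta>"
proof -
  have "((\<lambda>t. ennreal \<bar>\<phi> t (shift (- t) \<omega>) 0 - c\<bar>) \<longlongrightarrow> ennreal 0) at_top" using lim by simp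
  then have "((\<lambda>t. \<bar>\<phi> t (shift (- t) \<omega>) 0 - c\<bar>) \<longlongrightarrow> 0) at_top"
    by (subst (asm) tendsto_ennreal_iff) auto
  then have conv: "((\<lambda>t. \<phi> t (shift (- t) \<omega>) 0) \<longlongrightarrow> c) at_top"
    by (subst (asm) tendsto_rabs_zero_iff) (simp add: LIM_zero_iff)
  have "isCont (\<lambda>y. \<phi> s \<omega> y) c"
    by (rule DERIV_isCont[OF flow_has_derivative(2)[OF w s]])
  from isCont_tendsto_compose[OF this conv]
  have "((\<lambda>t. \<bar>\<phi> s \<omega> (\<phi> t (shift (- t) \<omega>) 0)\<bar>) \<longlongrightarrow> \<bar>\<phi> s \<omega> c\<bar>) at_top" by (rule tendsto_rabs)
  moreover have "\<forall>\<^sub>F t in at_top. \<bar>\<phi> s \<omega> (\<phi> t (shift (- t) \<omega>) 0)\<bar> \<le> \<eta>"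
    using eventually_ge_at_top[of r]
  proof eventually_elim
    case (elim t)
    let ?y = "\<phi> (t - r) (shift (- t) \<omega>) 0"
    have "\<phi> t (shift (- t) \<omega>) 0 = \<phi> r (shift (- r) \<omega>) ?y"
      using cocycle[OF shift_space[OF w], of "t - r" r "- t" 0] elim r by (simp add: shift_shift)
    moreover have "\<phi> (r + s) (shift (- r) \<omega>) ?y = \<phi> s \<omega> (\<phi> r (shift (- r) \<omega>) ?y)"
      using cocycle[OF shift_space[OF w] r s, of "- r" ?y] w by (simp add: shift_shift shift_0 space_P)
    ultimately show ?case using bound[of ?y] by simp
  qed
  ultimately show ?thesis by (rule tendsto_upperbound) simp
qed

text \<open>On the noise event \<open>E\<close> every solution started at time
  \<open>-(S + 1)\<close> stays within \<open>\<eta>\<close> of 0 on \<open>{0..T}\<close>. The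
  pullback property transfers this to the equilibrium, and the support theorem gives
  \<open>E\<close> positive probability.\<close>

lemma prob_lyapunov_pos:
  assumes "0 < \<beta>" "\<sigma> \<noteq> 0" "0 < T"
    and kicks: "\<And>a b z \<rho>. a < b \<Longrightarrow> 0 < \<bar>z\<bar> \<Longrightarrow> \<bar>z\<bar> < 1 \<Longrightarrow> 0 < \<rho> \<Longrightarrow>
      \<exists>J\<in>sets P. measure P J > 0 \<and> J \<subseteq> space P \<and> (\<forall>\<omega>\<in>J. \<exists>u\<in>{a<..b}. \<bar>jump \<omega> u - z\<bar> < \<rho>)"
    and equilibrium: "attracting_random_equilibrium P \<phi> a"
  shows "measure P {\<omega> \<in> space P. finite_time_lyapunov \<phi> a T \<omega> > 0} > 0"
proof -
  \<comment> \<open>\<open>R\<close> is one unit of time for the descent of \<open>Y\<close> plus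
    the observation time. The value of \<open>\<eta>\<close> gives
    \<open>3 * \<eta>^2 = \<beta> / 4\<close>, \<open>\<epsilon>\<close> makes the tracking error
    equal to \<open>\<eta>\<close>, and \<open>c\<close> gives \<open>3 * c^2 = 9 * \<beta>\<close>,
    above the contraction threshold \<open>8 * \<beta>\<close>.\<close>
  define R where "R = 1 + T"
  define \<eta> where "\<eta> = sqrt (\<beta> / 12)"
  define \<epsilon> where "\<epsilon> = \<eta> * exp (- (2 * \<beta> * R)) / 3"
  define S where "S = 8 / \<epsilon>^2"
  define c where "c = sqrt (3 * \<beta>)"
  have \<eta>: "0 < \<eta>" "3 * \<eta>^2 < \<beta>" using \<open>0 < \<beta>\<close> by (auto simp: \<eta>_def)
  have \<epsilon>: "0 < \<epsilon>" "3 * \<epsilon> * exp (2 * \<beta> * R) = \<eta>" using \<eta> by (auto simp: \<epsilon>_def exp_minus)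
  have S: "0 < S" using \<epsilon>(1) by (simp add: S_def)
  have c: "c^2 = 3 * \<beta>" using \<open>0 < \<beta>\<close> by (simp add: c_def)
  define Y where "Y t = c * max 0 (min 1 (S + 1 - t))" for t
  let ?p = "\<lambda>s. \<beta> * Y s - Y s ^ 3"
  \<comment> \<open>Up to an additive constant, \<open>f\<close> is the path whose noise makes
    \<open>Y\<close> a solution on \<open>{0..S+R}\<close>; freezing the integral outside this
    interval gives continuity on the whole line. The time shift in \<open>Z\<close> places target
    time \<open>S + 1\<close> at time 0.\<close>
  define f where "f t = (Y t - integral {0..max 0 (min (S + R) t)} ?p) / \<sigma>" for t
  define Z where "Z u \<omega> = \<omega> u - f (u + (S + 1))" for u and \<omega> :: "real \<Rightarrow> real"
  have contY: "continuous_on A Y" for A unfolding Y_def by (intro continuous_intros)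
  have contf: "continuous_on UNIV f"
  proof -
    have "continuous_on {0..S+R} (\<lambda>t. integral {0..t} ?p)"
      by (intro indefinite_integral_continuous_1 integrable_continuous_real continuous_intros contY)
    then have "continuous_on UNIV (\<lambda>t. integral {0..max 0 (min (S + R) t)} ?p)"
      by (rule continuous_on_compose2) (use S \<open>0 < T\<close> in \<open>auto simp: R_def intro!: continuous_intros\<close>)
    then show ?thesis unfolding f_def using \<open>\<sigma> \<noteq> 0\<close> by (intro continuous_intros contY) auto
  qed
  interpret kicked_process P Z
    unfolding Z_def
    by (rule levy_kicked_process[OF levy _ kicks])
      (auto intro!: continuous_on_compose2[OF contf] continuous_intros)
  define E where "E = flat (- (S + 1)) T (\<epsilon> / \<bar>\<sigma>\<bar>)"
  have E: "prob E > 0" "E \<in> events"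
    unfolding E_def using S \<epsilon>(1) \<open>\<sigma> \<noteq> 0\<close> \<open>0 < T\<close> by (auto intro!: prob_flat_pos)
  have near_zero: "\<bar>\<phi> ((S + 1) + s) (shift (- (S + 1)) \<omega>) x\<bar> \<le> \<eta>"
    if w: "\<omega> \<in> E" and s: "0 \<le> s" "s \<le> T" for \<omega> s x
  proof -
    have sp: "\<omega> \<in> space P" using w by (auto simp: E_def flat_def)
    let ?w = "shift (- (S + 1)) \<omega>"
    have "\<bar>\<phi> ((S + 1) + s) ?w x - Y ((S + 1) + s)\<bar> \<le> 3 * \<epsilon> * exp (2 * \<beta> * R)"
    proof (rule solution_tracks_target[OF solution[OF shift_space[OF sp]] cadlag_path[OF shift_space[OF sp]]])
      show "0 < \<beta>" "0 < \<epsilon>" "8 / \<epsilon>^2 \<le> S" "0 \<le> R" "continuous_on UNIV Y"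
        "S \<le> (S + 1) + s" "(S + 1) + s \<le> S + R"
        using assms \<epsilon>(1) contY s by (auto simp: S_def R_def)
      show "8 * \<beta> \<le> 3 * Y t ^ 2" if "0 \<le> t" "t < S" for t
        using that c \<open>0 < \<beta>\<close> by (simp add: Y_def)
      fix t assume t: "0 \<le> t" "t \<le> S + R"
      have "\<bar>Z (t - (S + 1)) \<omega> - Z (- (S + 1)) \<omega>\<bar> \<le> \<epsilon> / \<bar>\<sigma>\<bar>"
        using w t by (auto simp: E_def flat_def R_def)
      then have "\<bar>\<sigma>\<bar> * \<bar>Z (t - (S + 1)) \<omega> - Z (- (S + 1)) \<omega>\<bar> \<le> \<epsilon>"
        using \<open>\<sigma> \<noteq> 0\<close> by (simp add: field_simps)
      then have "\<bar>\<sigma> * (Z (t - (S + 1)) \<omega> - Z (- (S + 1)) \<omega>)\<bar> \<le> \<epsilon>" by (simp add: abs_mult)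
      moreover have "\<sigma> * (Z (t - (S + 1)) \<omega> - Z (- (S + 1)) \<omega>) = \<sigma> * ?w t - (\<sigma> * f t - \<sigma> * f 0)"
        by (simp add: Z_def shift_def algebra_simps)
      moreover have "\<sigma> * f t = Y t - integral {0..t} ?p" "\<sigma> * f 0 = Y 0"
        using t S \<open>\<sigma> \<noteq> 0\<close> by (auto simp: f_def)
      ultimately show "\<bar>\<sigma> * ?w t - (Y t - Y 0 - integral {0..t} ?p)\<bar> \<le> \<epsilon>"
        by (simp add: algebra_simps)
    qed
    moreover have "Y ((S + 1) + s) = 0" using s by (simp add: Y_def)
    ultimately show ?thesis using \<epsilon>(2) by simp
  qed
  have meas_a: "a \<in> borel_measurable P"
    and pullback: "AE \<omega> in P. \<forall>B. bounded B \<longrightarrow>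
      ((\<lambda>t. SUP x\<in>B. ennreal \<bar>\<phi> t (shift (- t) \<omega>) x - a \<omega>\<bar>) \<longlongrightarrow> 0) at_top"
    using equilibrium by (auto simp: attracting_random_equilibrium_def)
  have "AE \<omega> in P. \<omega> \<in> E \<longrightarrow> \<omega> \<in> {\<omega> \<in> space P. finite_time_lyapunov \<phi> a T \<omega> > 0}"
    using pullback
  proof eventually_elim
    case (elim \<omega>)
    show ?case
    proof
      assume w: "\<omega> \<in> E"
      then have sp: "\<omega> \<in> space P" by (auto simp: E_def flat_def)
      have "finite_time_lyapunov \<phi> a T \<omega> > 0"
      proof (rule lyapunov_pos[OF sp \<open>0 < T\<close> \<eta>(2)])
        show "\<bar>\<phi> s \<omega> (a \<omega>)\<bar> \<le> \<eta>" if "0 \<le> s" "s \<le> T" for s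
        proof (rule equilibrium_bound[OF sp, of "S + 1"])
          show "((\<lambda>t. SUP x\<in>{0}. ennreal \<bar>\<phi> t (shift (- t) \<omega>) x - a \<omega>\<bar>) \<longlongrightarrow> 0) at_top"
            by (rule elim[rule_format]) simp
          show "\<bar>\<phi> (S + 1 + s) (shift (- (S + 1)) \<omega>) x\<bar> \<le> \<eta>" for x
            by (rule near_zero[OF w that])
        qed (use S that in auto)
      qed (use \<eta> in auto)
      then show "\<omega> \<in> {\<omega> \<in> space P. finite_time_lyapunov \<phi> a T \<omega> > 0}" using sp by simp
    qed
  qed
  moreover have "{\<omega> \<in> space P. finite_time_lyapunov \<phi> a T \<omega> > 0} \<in> events"
    by (intro borel_measurable_less lyapunov_measurable[OF _ meas_a]) (use \<open>0 < T\<close> in simp_all)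
  ultimately have "prob E \<le> prob {\<omega> \<in> space P. finite_time_lyapunov \<phi> a T \<omega> > 0}"
    by (rule finite_measure_mono_AE)
  then show ?thesis using E(1) by simp
qed

end

theorem theorem3p5:
  fixes \<alpha> \<sigma> \<beta> :: real
    and P :: "(real \<Rightarrow> real) measure"
    and \<phi> :: "real \<Rightarrow> (real \<Rightarrow> real) \<Rightarrow> real \<Rightarrow> real"
    and a :: "(real \<Rightarrow> real) \<Rightarrow> real"
  assumes "1 < \<alpha>" and "\<alpha> < 2" and "\<sigma> \<noteq> 0"
    and "truncated_stable_process \<alpha> P \<or> stable_process \<alpha> P"
    and "generated_rds P \<beta> \<sigma> \<phi>"
    and "attracting_random_equilibrium P \<phi> a"
  shows "(\<beta> < 0 \<longrightarrow>
           (\<forall>T>0. \<forall>\<omega>\<in>space P.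
              finite_time_lyapunov \<phi> a T \<omega> \<le> \<beta> \<and> \<beta> < 0)) \<and>
         (\<beta> > 0 \<longrightarrow>
           (\<forall>T>0. measure P {\<omega> \<in> space P. finite_time_lyapunov \<phi> a T \<omega> > 0} > 0))"
proof -
  \<comment> \<open>From here on the two kinds of noise differ only in the Levy measure
    \<open>\<nu>\<close>, which in both cases charges every nonempty open interval within
    \<open>(-1,1)\<close>.\<close>
  obtain \<nu> where \<nu>: "\<nu> = stable_levy_measure \<alpha> \<or> \<nu> = truncated_stable_levy_measure \<alpha>"
    and levy_P: "two_sided_levy_process P" "levy_measure_of \<nu> P"
    using assms(4) by (auto simp: stable_process_def truncated_stable_process_def)
  interpret cubic_sde P \<beta> \<sigma> \<phi>
    using levy_P(1) assms(5) by unfold_locales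
  have "prob_space P" using levy by (simp add: two_sided_levy_process_def)
  then have "\<exists>J\<in>sets P. measure P J > 0 \<and> J \<subseteq> space P \<and> (\<forall>\<omega>\<in>J. \<exists>u\<in>{a<..b}. \<bar>jump \<omega> u - z\<bar> < \<rho>)"
    if "a < b" "0 < \<bar>z\<bar>" "\<bar>z\<bar> < 1" "0 < \<rho>" for a b z \<rho>
    using assms(1,2) \<nu> levy_P(2) that by (intro stable_kicks[of \<alpha> P \<nu>]) auto
  from prob_lyapunov_pos[OF _ assms(3) _ this assms(6)] show ?thesis
    using lyapunov_le by blast
qed

end
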